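(* Let $d\ge1$ be an integer and let $q>2/(d+2)$. Then $$\inf\Big\{F_q(\Omega)\ :\ \Omega\text{ open in }\mathbb{R}^d,\ 0<|\Omega|<\infty\Big\}=0.$$
   Context: For an open set $\Omega\subset\mathbb{R}^d$ with Lebesgue measure $0<|\Omega|<\infty$: $\lambda(\Omega)=\min\{\int_\Omega|\nabla u|^2dx\,/\int_\Omega u^2dx : u\in H^1_0(\Omega),\ u\ne0\}$ is the first eigenvalue of the Dirichlet Laplacian; $T(\Omega)=\int_\Omega w_\Omega\,dx$ is the torsional rigidity, where $w_\Omega\in H^1_0(\Omega)$ is the unique weak solution of $-\Delta w=1$ in $\Omega$. For $q>0$, $$F_q(\Omega)=\frac{\lambda(\Omega)\,T(\Omega)^q}{|\Omega|^{(dq+2q-2)/d}}.$$ *)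

theory Defs
  imports "HOL-Analysis.Analysis"
begin

text \<open>Functions on an open set \<open>\<Omega>\<close> are total functions on the ambient Euclidean space; only
  their restriction to \<open>\<Omega>\<close> matters, up to null sets, because all integrals below are taken with
  respect to \<open>lebesgue_on \<Omega>\<close>. The dimension \<open>d\<close> is \<open>DIM('a)\<close>.\<close>

primrec C_k :: "nat \<Rightarrow> ('a::euclidean_space \<Rightarrow> real) \<Rightarrow> bool" where
  "C_k 0 f \<longleftrightarrow> continuous_on UNIV f"
| "C_k (Suc k) f \<longleftrightarrow>
     (\<forall>x. f differentiable (at x)) \<and>
     (\<forall>b\<in>Basis. C_k k (\<lambda>x. frechet_derivative f (at x) b))"

definition test_function :: "'a::euclidean_space set \<Rightarrow> ('a \<Rightarrow> real) \<Rightarrow> bool" where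
  "test_function \<Omega> \<phi> \<longleftrightarrow>
     (\<forall>k. C_k k \<phi>) \<and> compact (closure {x. \<phi> x \<noteq> 0}) \<and> closure {x. \<phi> x \<noteq> 0} \<subseteq> \<Omega>"

definition classical_grad :: "('a::euclidean_space \<Rightarrow> real) \<Rightarrow> 'a \<Rightarrow> 'a" where
  "classical_grad \<phi> x = (\<Sum>b\<in>Basis. frechet_derivative \<phi> (at x) b *\<^sub>R b)"

definition L2_on :: "'a::euclidean_space set \<Rightarrow> ('a \<Rightarrow> 'b::euclidean_space) \<Rightarrow> bool" where
  "L2_on \<Omega> f \<longleftrightarrow>
     f \<in> borel_measurable (lebesgue_on \<Omega>) \<and> integrable (lebesgue_on \<Omega>) (\<lambda>x. (norm (f x))\<^sup>2)"

definition has_weak_grad ::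
  "'a::euclidean_space set \<Rightarrow> ('a \<Rightarrow> real) \<Rightarrow> ('a \<Rightarrow> 'a) \<Rightarrow> bool" where
  "has_weak_grad \<Omega> u g \<longleftrightarrow>
     L2_on \<Omega> u \<and> L2_on \<Omega> g \<and>
     (\<forall>\<phi>. test_function \<Omega> \<phi> \<longrightarrow> (\<forall>b\<in>Basis.
        (LINT x|lebesgue_on \<Omega>. u x * (classical_grad \<phi> x \<bullet> b)) =
        - (LINT x|lebesgue_on \<Omega>. (g x \<bullet> b) * \<phi> x)))"

definition H1 :: "'a::euclidean_space set \<Rightarrow> ('a \<Rightarrow> real) set" where
  "H1 \<Omega> = {u. \<exists>g. has_weak_grad \<Omega> u g}"

text \<open>The weak gradient is unique up to a null set of \<open>\<Omega>\<close>, and it is only used under integrals,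
  so the choice of a representative is immaterial.\<close>

definition weak_grad :: "'a::euclidean_space set \<Rightarrow> ('a \<Rightarrow> real) \<Rightarrow> 'a \<Rightarrow> 'a" where
  "weak_grad \<Omega> u = (SOME g. has_weak_grad \<Omega> u g)"

text \<open>The closure of the test functions in the norm of \<open>H1\<close>.\<close>

definition H10 :: "'a::euclidean_space set \<Rightarrow> ('a \<Rightarrow> real) set" where
  "H10 \<Omega> = {u \<in> H1 \<Omega>. \<exists>\<phi> :: nat \<Rightarrow> 'a \<Rightarrow> real.
     (\<forall>n. test_function \<Omega> (\<phi> n)) \<and>
     (\<lambda>n. (LINT x|lebesgue_on \<Omega>. (u x - \<phi> n x)\<^sup>2)
         + (LINT x|lebesgue_on \<Omega>. (norm (weak_grad \<Omega> u x - classical_grad (\<phi> n) x))\<^sup>2))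
       \<longlonglongrightarrow> 0}"

text \<open>For nonempty open \<open>\<Omega>\<close> of finite measure the infimum is attained, hence a minimum. The
  condition \<open>u \<noteq> 0\<close> in \<open>H10 \<Omega>\<close> means that \<open>u\<close> is not almost everywhere zero on \<open>\<Omega>\<close>.\<close>

definition first_eigenvalue :: "'a::euclidean_space set \<Rightarrow> real" where
  "first_eigenvalue \<Omega> =
     Inf {(LINT x|lebesgue_on \<Omega>. (norm (weak_grad \<Omega> u x))\<^sup>2) / (LINT x|lebesgue_on \<Omega>. (u x)\<^sup>2) | u.
            u \<in> H10 \<Omega> \<and> \<not> (AE x in lebesgue_on \<Omega>. u x = 0)}"

definition weak_torsion_solution :: "'a::euclidean_space set \<Rightarrow> ('a \<Rightarrow> real) \<Rightarrow> bool" where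
  "weak_torsion_solution \<Omega> w \<longleftrightarrow>
     w \<in> H10 \<Omega> \<and>
     (\<forall>v\<in>H10 \<Omega>. (LINT x|lebesgue_on \<Omega>. weak_grad \<Omega> w x \<bullet> weak_grad \<Omega> v x) =
                 (LINT x|lebesgue_on \<Omega>. v x))"

text \<open>For open \<open>\<Omega>\<close> of finite measure the weak solution exists and is unique up to a null set
  of \<open>\<Omega>\<close>; \<open>SOME\<close> picks a representative.\<close>

definition torsion_function :: "'a::euclidean_space set \<Rightarrow> 'a \<Rightarrow> real" where
  "torsion_function \<Omega> = (SOME w. weak_torsion_solution \<Omega> w)"

definition torsional_rigidity :: "'a::euclidean_space set \<Rightarrow> real" where
  "torsional_rigidity \<Omega> = (LINT x|lebesgue_on \<Omega>. torsion_function \<Omega> x)"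

definition F_functional :: "real \<Rightarrow> 'a::euclidean_space set \<Rightarrow> real" where
  "F_functional q \<Omega> =
     first_eigenvalue \<Omega> * torsional_rigidity \<Omega> powr q /
     measure lebesgue \<Omega> powr ((real DIM('a) * q + 2 * q - 2) / real DIM('a))"

end

theory Submission
  imports Defs
begin

text \<open>
  Add to the unit ball \<open>n ^ (d + 2)\<close> disjoint balls of radius \<open>1 / n\<close>. The first eigenvalue does not increase,
  because a fixed test function on the unit ball remains admissible; the torsional rigidity, which
  is additive and scales like the power \<open>d + 2\<close> of the radius, stays bounded; but the volume grows
  like \<open>n\<^sup>2\<close>, and the exponent of the volume is positive when \<open>q > 2 / (d + 2)\<close>.

  On a disjoint union of balls the torsion function is explicit, namely
  \<open>(r\<^sup>2 - \<bar>x - c\<bar>\<^sup>2) / (2 d)\<close> on the ball of center \<open>c\<close> and radius \<open>r\<close>, so no abstract existence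
  theorem for the weak solution is needed.
\<close>

section \<open>Iterated differentiability and a smooth cutoff\<close>

text \<open>The count n^(d + 2) comes from homogeneity: up to constants, N balls of radius r
  contribute N r^(d + 2) to the torsional rigidity and N r^d to the volume, so r = 1 / n and N =
  n^(d + 2) keep the first at 1 while the second is n^2. Dilations alone achieve nothing, since the
  exponent of the volume makes F_q invariant under them. Besides the exact volume, only upper bounds
  for the eigenvalue and the rigidity enter. The lower bound 0, which concerns arbitrary sets, needs
  only the sign of the eigenvalue, because a \<open>powr\<close> is nonnegative whatever its base.

  The work lies in the encoding. \<open>weak_grad\<close> and \<open>torsion_function\<close> are
  picked by \<open>SOME\<close>, so an explicit candidate says something about them only once weak
  gradients are known to agree almost everywhere and weak solutions to have equal integrals.
  \<open>H10\<close> asks for approximation by smooth functions of compact support, while the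
  explicit torsion function has a kink at the boundary of each ball; this is why a calculus of
  smooth cutoffs comes at the start.\<close>

text \<open>Derivatives are unique, so any exhibited derivative may replace the chosen
  \<open>frechet_derivative\<close>; the closure properties of \<open>C_k\<close> are proved through
  this rule.\<close>

lemma C_k_SucI:
  assumes "\<And>x. (f has_derivative D x) (at x)"
    and "\<And>b. b \<in> Basis \<Longrightarrow> C_k k (\<lambda>x. D x b)"
  shows "C_k (Suc k) f"
proof -
  have "frechet_derivative f (at x) = D x" for x
    using frechet_derivative_at[OF assms(1)] by simp
  then show ?thesis
    using assms by (auto simp: differentiable_def)
qed

lemma C_k_SucD:
  assumes "C_k (Suc k) f"
  shows "(f has_derivative frechet_derivative f (at x)) (at x)"
    and "b \<in> Basis \<Longrightarrow> C_k k (\<lambda>x. frechet_derivative f (at x) b)"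
  using assms by (auto simp: frechet_derivative_works)

lemma C_k_Suc_imp: "C_k (Suc k) f \<Longrightarrow> C_k k f"
proof (induction k arbitrary: f)
  case 0
  then show ?case
    by (auto intro!: differentiable_imp_continuous_on simp: differentiable_on_def
        intro: differentiable_at_withinI)
next
  case (Suc k)
  then show ?case
    unfolding C_k.simps(2)[of "Suc k"] C_k.simps(2)[of k f] by blast
qed

lemma C_k_continuous: "C_k k f \<Longrightarrow> continuous_on UNIV f"
  by (induction k) (use C_k_Suc_imp in auto)

lemma C_k_const: "C_k k (\<lambda>x. c)"
proof (induction k arbitrary: c)
  case (Suc k)
  show ?case
    by (rule C_k_SucI[where D = "\<lambda>x h. 0"]) (use Suc in auto)
qed simp

lemma C_k_add: "C_k k f \<Longrightarrow> C_k k g \<Longrightarrow> C_k k (\<lambda>x. f x + g x)"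
proof (induction k arbitrary: f g)
  case 0
  then show ?case by (auto intro: continuous_intros)
next
  case (Suc k)
  show ?case
  proof (rule C_k_SucI)
    show "((\<lambda>x. f x + g x) has_derivative
      (\<lambda>h. frechet_derivative f (at x) h + frechet_derivative g (at x) h)) (at x)" for x
      by (intro has_derivative_add C_k_SucD(1)[OF Suc.prems(1)] C_k_SucD(1)[OF Suc.prems(2)])
    show "C_k k (\<lambda>x. frechet_derivative f (at x) b + frechet_derivative g (at x) b)"
      if "b \<in> Basis" for b
      by (intro Suc.IH C_k_SucD(2)[OF Suc.prems(1)] C_k_SucD(2)[OF Suc.prems(2)] that)
  qed
qed

lemma C_k_mult: "C_k k f \<Longrightarrow> C_k k g \<Longrightarrow> C_k k (\<lambda>x. f x * g x)"
proof (induction k arbitrary: f g)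
  case 0
  then show ?case by (auto intro: continuous_intros)
next
  case (Suc k)
  show ?case
  proof (rule C_k_SucI)
    show "((\<lambda>x. f x * g x) has_derivative
      (\<lambda>h. f x * frechet_derivative g (at x) h + frechet_derivative f (at x) h * g x)) (at x)" for x
      by (intro has_derivative_mult C_k_SucD(1)[OF Suc.prems(1)] C_k_SucD(1)[OF Suc.prems(2)])
    show "C_k k (\<lambda>x. f x * frechet_derivative g (at x) b + frechet_derivative f (at x) b * g x)"
      if "b \<in> Basis" for b
      by (intro C_k_add Suc.IH C_k_SucD(2)[OF Suc.prems(1)] C_k_SucD(2)[OF Suc.prems(2)] that
          C_k_Suc_imp[OF Suc.prems(1)] C_k_Suc_imp[OF Suc.prems(2)])
  qed
qed

lemma C_k_comp:
  fixes f :: "real \<Rightarrow> real"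
  shows "C_k k f \<Longrightarrow> C_k k g \<Longrightarrow> C_k k (\<lambda>x. f (g x))"
proof (induction k arbitrary: f g)
  case 0
  then show ?case
    by (auto intro: continuous_on_compose2)
next
  case (Suc k)
  let ?f' = "\<lambda>y. frechet_derivative f (at y) 1"
  \<comment> \<open>A linear map on the real line is multiplication by its value at 1, the only
    basis vector. This turns the chain rule into a product to which the induction hypothesis and
    \<open>C_k_mult\<close> apply.\<close>
  have f': "frechet_derivative f (at y) h = ?f' y * h" for y h
    using linear_scale[OF has_derivative_linear[OF C_k_SucD(1)[OF Suc.prems(1), of y]], of h 1]
    by (simp add: mult.commute)
  show ?case
  proof (rule C_k_SucI)
    show "((\<lambda>x. f (g x)) has_derivative
      (\<lambda>h. ?f' (g x) * frechet_derivative g (at x) h)) (at x)" for x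
      using has_derivative_compose[OF C_k_SucD(1)[OF Suc.prems(2)] C_k_SucD(1)[OF Suc.prems(1)]]
      by (subst f'[symmetric])
    show "C_k k (\<lambda>x. ?f' (g x) * frechet_derivative g (at x) b)" if "b \<in> Basis" for b
      using Suc.IH[of ?f' g] C_k_SucD(2)[OF Suc.prems(1), of 1] C_k_SucD(2)[OF Suc.prems(2) that]
        C_k_Suc_imp[OF Suc.prems(2)] by (simp add: C_k_mult)
  qed
qed

lemma C_k_inner: "C_k k (\<lambda>x. x \<bullet> v)"
proof (cases k)
  case (Suc m)
  show ?thesis unfolding Suc
    by (rule C_k_SucI[where D = "\<lambda>x h. h \<bullet> v"]) (auto intro!: derivative_eq_intros C_k_const)
qed (auto intro: continuous_intros)

lemma C_k_id: "C_k k (\<lambda>x::real. x)"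
  using C_k_inner[of k "1::real"] by simp

lemma C_k_sum: "(\<And>i. i \<in> I \<Longrightarrow> C_k k (f i)) \<Longrightarrow> C_k k (\<lambda>x. \<Sum>i\<in>I. f i x)"
  by (induction I rule: infinite_finite_induct) (auto intro: C_k_const C_k_add)

lemma C_k_prod: "(\<And>i. i \<in> I \<Longrightarrow> C_k k (f i)) \<Longrightarrow> C_k k (\<lambda>x. \<Prod>i\<in>I. f i x)"
  by (induction I rule: infinite_finite_induct) (auto intro: C_k_const C_k_mult)

lemma C_k_diff: "C_k k f \<Longrightarrow> C_k k g \<Longrightarrow> C_k k (\<lambda>x. f x - g x)"
  using C_k_add[of k f "\<lambda>x. -1 * g x"] C_k_mult[OF C_k_const, of k g "-1"] by simp

text \<open>The case m = 0 is the classical smooth function exp (-1/t) that is flat at 0. The powers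
  of 1/t are included so that the derivative of each member is a linear combination of
  members.\<close>

definition bump :: "nat \<Rightarrow> real \<Rightarrow> real" where
  "bump m t = (if t > 0 then inverse t ^ m * exp (- inverse t) else 0)"

lemma bump_tendsto_0: "(bump m \<longlongrightarrow> 0) (at 0)"
proof -
  have "((\<lambda>y::real. y ^ m / exp y) \<longlongrightarrow> 0) at_top"
    by (rule tendsto_power_div_exp_0)
  then have "((\<lambda>t::real. inverse t ^ m / exp (inverse t)) \<longlongrightarrow> 0) (at_right 0)"
    by (rule filterlim_compose[OF _ filterlim_inverse_at_top_right])
  then have "(bump m \<longlongrightarrow> 0) (at_right 0)"
    by (rule Lim_transform_eventually)
      (auto simp: eventually_at_filter bump_def exp_minus divide_inverse)
  moreover have "(bump m \<longlongrightarrow> 0) (at_left 0)"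
    by (rule Lim_transform_eventually[where f="\<lambda>_. 0"])
      (auto simp: eventually_at_filter bump_def)
  ultimately show ?thesis
    by (simp add: filterlim_split_at)
qed

lemma bump_has_derivative:
  "(bump m has_real_derivative bump (m + 2) t - real m * bump (m + 1) t) (at t)"
proof -
  consider "t > 0" | "t = 0" | "t < 0" by linarith
  then show ?thesis
  proof cases
    case 1
    have "((\<lambda>t. inverse t ^ m) has_real_derivative - real m * inverse t ^ Suc m) (at t)"
      by (rule DERIV_cong[OF DERIV_power[OF DERIV_inverse]]; cases m)
        (use 1 in \<open>auto simp: algebra_simps\<close>)
    moreover have "((\<lambda>t. exp (- inverse t)) has_real_derivative
        exp (- inverse t) * inverse t ^ 2) (at t)"
      using 1 by (auto intro!: derivative_eq_intros simp: power2_eq_square)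
    ultimately have "((\<lambda>t. inverse t ^ m * exp (- inverse t)) has_real_derivative
        bump (m + 2) t - real m * bump (m + 1) t) (at t)"
      by (rule DERIV_cong[OF DERIV_mult])
        (use 1 in \<open>simp add: bump_def algebra_simps power2_eq_square\<close>)
    then show ?thesis
      by (rule has_field_derivative_transform_within_open[where S="{0<..}"])
        (use 1 in \<open>auto simp: bump_def\<close>)
  next
    case 2
    \<comment> \<open>The difference quotient at 0 is again in the family: dividing by h gives
      \<open>bump (Suc m) h\<close>, which tends to 0.\<close>
    have "((\<lambda>h. (bump m (0 + h) - bump m 0) / h) \<longlongrightarrow> 0) (at 0)"
      by (rule Lim_transform_eventually[OF bump_tendsto_0[of "Suc m"]])
        (auto simp: eventually_at_filter bump_def divide_inverse mult_ac)
    then show ?thesis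
      using 2 by (simp add: DERIV_def bump_def)
  next
    case 3
    have "((\<lambda>t. 0) has_real_derivative
        bump (m + 2) t - real m * bump (m + 1) t) (at t)"
      using 3 by (auto simp: bump_def)
    then show ?thesis
      by (rule has_field_derivative_transform_within_open[where S="{..<0}"])
        (use 3 in \<open>auto simp: bump_def\<close>)
  qed
qed

text \<open>Differentiation raises the index m, so the induction on k must treat all m
  simultaneously.\<close>

lemma C_k_bump: "C_k k (bump m)"
proof (induction k arbitrary: m)
  case 0
  then show ?case
    by (auto intro!: DERIV_continuous_on bump_has_derivative simp: has_field_derivative_at_within)
next
  case (Suc k)
  show ?case
  proof (rule C_k_SucI)
    show "(bump m has_derivative (\<lambda>h. (bump (m + 2) t - real m * bump (m + 1) t) * h)) (at t)" for t
      using bump_has_derivative[of m t] by (simp add: has_field_derivative_def)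
    show "C_k k (\<lambda>t. (bump (m + 2) t - real m * bump (m + 1) t) * b)" for b
      by (intro C_k_mult C_k_diff C_k_const Suc.IH)
  qed
qed

lemma bump_nonneg: "0 \<le> bump m t"
  by (auto simp: bump_def)

lemma bump_pos_iff: "0 < bump m t \<longleftrightarrow> 0 < t"
  by (auto simp: bump_def)

lemma bump_0_le_1: "bump 0 t \<le> 1"
  by (auto simp: bump_def)

lemma bump_1_le_1: "bump 1 t \<le> 1"
proof -
  have "x * exp (- x) \<le> 1" if "x > 0" for x :: real
  proof -
    have "x \<le> exp x"
      using exp_ge_add_one_self[of x] by linarith
    then show ?thesis
      by (simp add: exp_minus field_simps)
  qed
  then show ?thesis by (auto simp: bump_def)
qed

lemma bump_tendsto_at_top:
  shows "(bump 0 \<longlongrightarrow> 1) at_top" and "(bump 1 \<longlongrightarrow> 0) at_top"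
proof -
  \<comment> \<open>The factor \<open>0 ^ m\<close> covers both claims: it is 1 for m = 0 and 0 for
    m = 1.\<close>
  have lim: "((\<lambda>t::real. inverse t ^ m * exp (- inverse t)) \<longlongrightarrow> 0 ^ m * exp (- 0)) at_top" for m
    by (intro tendsto_intros tendsto_inverse_0_at_top filterlim_ident)
  have ev: "eventually (\<lambda>t. inverse t ^ m * exp (- inverse t) = bump m t) at_top" for m
    using eventually_gt_at_top[of 0] by eventually_elim (simp add: bump_def)
  show "(bump 0 \<longlongrightarrow> 1) at_top" "(bump 1 \<longlongrightarrow> 0) at_top"
    using Lim_transform_eventually[OF lim[of 0] ev] Lim_transform_eventually[OF lim[of 1] ev] by auto
qed

section \<open>Test functions and integration by parts\<close>

lemma test_functionI:
  assumes "\<And>k. C_k k \<phi>" and "{x. \<phi> x \<noteq> 0} \<subseteq> K" "compact K" "K \<subseteq> \<Omega>"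
  shows "test_function \<Omega> \<phi>"
proof -
  have "closure {x. \<phi> x \<noteq> 0} \<subseteq> K"
    using assms by (simp add: closure_minimal compact_imp_closed)
  moreover from this have "compact (closure {x. \<phi> x \<noteq> 0})"
    using compact_Int_closed[OF assms(3) closed_closure, of "{x. \<phi> x \<noteq> 0}"]
    by (simp add: Int_absorb1)
  ultimately show ?thesis
    using assms unfolding test_function_def by (blast intro: order_trans)
qed

lemma test_function_has_derivative:
  "test_function \<Omega> \<phi> \<Longrightarrow> (\<phi> has_derivative frechet_derivative \<phi> (at x)) (at x)"
  unfolding test_function_def using C_k_SucD(1) by blast

lemma has_derivative_classical_grad:
  assumes "test_function \<Omega> \<phi>"
  shows "(\<phi> has_derivative (\<lambda>h. classical_grad \<phi> x \<bullet> h)) (at x)"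
proof -
  interpret linear "frechet_derivative \<phi> (at x)"
    using test_function_has_derivative[OF assms] by (rule has_derivative_linear)
  have "frechet_derivative \<phi> (at x) = (\<lambda>h. classical_grad \<phi> x \<bullet> h)"
  proof
    fix h
    have "frechet_derivative \<phi> (at x) (\<Sum>b\<in>Basis. (h \<bullet> b) *\<^sub>R b) = classical_grad \<phi> x \<bullet> h"
      by (simp only: sum scale classical_grad_def inner_sum_left inner_sum_right)
        (simp add: inner_commute mult.commute)
    then show "frechet_derivative \<phi> (at x) h = classical_grad \<phi> x \<bullet> h"
      by (simp add: euclidean_representation)
  qed
  then show ?thesis
    using test_function_has_derivative[OF assms, of x] by simp
qed

lemma test_function_continuous: "test_function \<Omega> \<phi> \<Longrightarrow> continuous_on A \<phi>"
  unfolding test_function_def using C_k_continuous continuous_on_subset by blast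

lemma classical_grad_continuous:
  assumes "test_function \<Omega> \<phi>"
  shows "continuous_on A (classical_grad \<phi>)"
proof -
  have "C_k 0 (\<lambda>x. frechet_derivative \<phi> (at x) b)" if "b \<in> Basis" for b
    using assms that C_k_SucD(2) unfolding test_function_def by blast
  then have "continuous_on UNIV (classical_grad \<phi>)"
    unfolding classical_grad_def by (intro continuous_intros) auto
  then show ?thesis by (rule continuous_on_subset) simp
qed

lemma test_function_outside:
  assumes "test_function \<Omega> \<phi>" "x \<notin> closure {x. \<phi> x \<noteq> 0}"
  shows "\<phi> x = 0" and "classical_grad \<phi> x = 0"
proof -
  note sub = closure_subset[of "{x. \<phi> x \<noteq> 0}"]
  show "\<phi> x = 0" using assms(2) sub by blast
  have "((\<lambda>x. 0) has_derivative (\<lambda>h. 0)) (at x)" by simp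
  then have "(\<phi> has_derivative (\<lambda>h. 0)) (at x)"
    by (rule has_derivative_transform_within_open[where s = "- closure {x. \<phi> x \<noteq> 0}"])
      (use assms(2) sub in \<open>auto simp: open_Compl\<close>)
  then have "frechet_derivative \<phi> (at x) = (\<lambda>h. 0)"
    by (rule frechet_derivative_at[symmetric])
  then show "classical_grad \<phi> x = 0"
    by (simp add: classical_grad_def)
qed

lemma test_function_bounded:
  assumes "test_function \<Omega> \<phi>"
  shows "bounded (range \<phi>)" and "bounded (range (classical_grad \<phi>))"
proof -
  let ?K = "closure {x. \<phi> x \<noteq> 0}"
  have K: "compact ?K" using assms by (simp add: test_function_def)
  have sub: "range \<phi> \<subseteq> insert 0 (\<phi> ` ?K)"
    "range (classical_grad \<phi>) \<subseteq> insert 0 (classical_grad \<phi> ` ?K)"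
    using test_function_outside[OF assms] by blast+
  have "bounded (insert 0 (\<phi> ` ?K))" "bounded (insert 0 (classical_grad \<phi> ` ?K))"
    unfolding bounded_insert
    by (intro compact_imp_bounded compact_continuous_image K test_function_continuous[OF assms]
        classical_grad_continuous[OF assms])+
  then show "bounded (range \<phi>)" "bounded (range (classical_grad \<phi>))"
    using bounded_subset sub by blast+
qed

text \<open>By translation invariance all difference quotients integrate to zero.\<close>

lemma integral_directional_derivative_eq_0:
  fixes f :: "'a::euclidean_space \<Rightarrow> real"
  assumes deriv: "\<And>x. (f has_derivative F x) (at x)"
    and bound: "\<And>x. \<bar>F x b\<bar> \<le> C"
    and S: "bounded S" and zero: "\<And>x. x \<notin> S \<Longrightarrow> f x = 0"
  shows "(LINT x|lborel. F x b) = 0"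
proof -
  obtain R where R: "S \<subseteq> cball 0 R" and "R > 0"
    using bounded_subset_ballD[OF S, of 0] ball_subset_cball by blast
  have C: "C \<ge> 0" using bound[of 0] by linarith
  have cont: "continuous_on A f" for A
    using deriv has_derivative_continuous_on has_derivative_at_withinI by blast
  have [measurable]: "f \<in> borel_measurable borel"
    using cont by (rule borel_measurable_continuous_onI)
  have zero_R: "f x = 0" if "x \<notin> cball 0 R" for x
    using R zero that by blast
  have "(\<lambda>x. indicator (cball 0 R) x *\<^sub>R f x) = f"
    using zero_R by (fastforce simp: fun_eq_iff indicator_def)
  then have int_f: "integrable lborel f"
    using borel_integrable_compact[OF compact_cball cont, of 0 R] by simp
  have shift: "integrable lborel (\<lambda>x. f (x + v))" "(LINT x|lborel. f (x + v)) = (LINT x|lborel. f x)" for v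
    using integrable_distr[of "(+) v" lborel borel f] integral_distr[of "(+) v" lborel borel f] int_f
    by (auto simp: lborel_distr_plus add.commute)
  have line: "((\<lambda>t. f (x + t *\<^sub>R b)) has_real_derivative F (x + t *\<^sub>R b) b) (at t)" for x t
  proof -
    have "((\<lambda>t. x + t *\<^sub>R b) has_derivative (\<lambda>h. h *\<^sub>R b)) (at t)"
      by (auto intro!: derivative_eq_intros)
    from has_derivative_compose[OF this deriv[of "x + t *\<^sub>R b"]]
    have "((\<lambda>t. f (x + t *\<^sub>R b)) has_derivative (\<lambda>h. F (x + t *\<^sub>R b) (h *\<^sub>R b))) (at t)" .
    moreover have "F (x + t *\<^sub>R b) (h *\<^sub>R b) = F (x + t *\<^sub>R b) b * h" for h
      using linear_scale[OF has_derivative_linear[OF deriv]] by simp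
    ultimately show ?thesis by (simp add: has_field_derivative_def)
  qed
  define s where "s n x = (f (x + inverse (real (Suc n)) *\<^sub>R b) - f x) / inverse (real (Suc n))" for n x
  have lim: "(\<lambda>n. s n x) \<longlonglongrightarrow> F x b" for x
  proof -
    have "((\<lambda>h. (f (x + h *\<^sub>R b) - f x) / h) \<longlongrightarrow> F x b) (at 0)"
      using line[of x 0] by (simp add: DERIV_def)
    moreover have "filterlim (\<lambda>n. inverse (real (Suc n))) (at 0) sequentially"
      using LIMSEQ_inverse_real_of_nat by (auto simp: filterlim_at)
    ultimately show ?thesis
      unfolding s_def by (rule filterlim_compose)
  qed
  \<comment> \<open>Domination for the limit: by the mean value theorem a quotient is a value of the
    directional derivative, and since the step is at most 1, the shift moves a point by at most
    \<open>norm b\<close>, whence the enlarged radius.\<close>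
  have s_bound: "\<bar>s n x\<bar> \<le> C * indicator (cball 0 (R + norm b)) x" for n x
  proof (cases "x \<in> cball 0 (R + norm b)")
    case True
    let ?t = "inverse (real (Suc n))"
    obtain z where "f (x + ?t *\<^sub>R b) - f (x + 0 *\<^sub>R b) = (?t - 0) * F (x + z *\<^sub>R b) b"
      using MVT2[of 0 ?t "\<lambda>t. f (x + t *\<^sub>R b)" "\<lambda>t. F (x + t *\<^sub>R b) b"] line by auto
    then have "s n x = F (x + z *\<^sub>R b) b" by (simp add: s_def)
    then show ?thesis using bound True by simp
  next
    case False
    have "norm (inverse (real (Suc n)) *\<^sub>R b) \<le> norm b"
      by (simp add: mult_left_le_one_le inverse_le_1_iff)
    moreover have "norm x > R + norm b" using False by simp
    ultimately have "norm (x + inverse (real (Suc n)) *\<^sub>R b) > R" "norm x > R"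
      using norm_diff_ineq[of x "inverse (real (Suc n)) *\<^sub>R b"] norm_ge_zero[of b] by linarith+
    then have "f (x + inverse (real (Suc n)) *\<^sub>R b) = 0" "f x = 0"
      by (auto intro: zero_R)
    then show ?thesis using False by (simp add: s_def)
  qed
  have [measurable]: "s n \<in> borel_measurable lborel" for n
    unfolding s_def by measurable
  have "(\<lambda>n. LINT x|lborel. s n x) \<longlonglongrightarrow> (LINT x|lborel. F x b)"
  proof (rule integral_dominated_convergence[where w="\<lambda>x. C * indicator (cball 0 (R + norm b)) x"])
    show "(\<lambda>x. F x b) \<in> borel_measurable lborel"
      using lim by (rule borel_measurable_LIMSEQ_real) simp
    show "integrable lborel (\<lambda>x. C * indicat_real (cball 0 (R + norm b)) x)"
      using emeasure_lborel_cball_finite[of 0 "R + norm b"]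
      by (intro integrable_mult_right integrable_real_indicator) auto
  qed (use lim s_bound in auto)
  moreover have "(LINT x|lborel. s n x) = 0" for n
    unfolding s_def using shift int_f by simp
  ultimately show ?thesis
    by (simp add: LIMSEQ_const_iff)
qed

text \<open>Translation invariance is exploited on \<open>lborel\<close>, whereas the definitions
  integrate over \<open>lebesgue_on \<Omega>\<close>. Passing to \<open>lborel\<close> also removes
  the dependence of an integral on the surrounding open set.\<close>

lemma integral_lebesgue_on_eq_lborel:
  fixes f :: "'a::euclidean_space \<Rightarrow> real"
  assumes "open \<Omega>" "f \<in> borel_measurable borel" "\<And>x. x \<notin> \<Omega> \<Longrightarrow> f x = 0"
  shows "(LINT x|lebesgue_on \<Omega>. f x) = (LINT x|lborel. f x)"
proof -
  have "(\<lambda>x. indicator \<Omega> x *\<^sub>R f x) = f"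
    using assms(3) by (auto simp: fun_eq_iff indicator_def)
  then have "(LINT x|lebesgue_on \<Omega>. f x) = (LINT x|lebesgue. f x)"
    using assms(1) by (simp add: integral_restrict_space)
  also have "\<dots> = (LINT x|lborel. f x)"
    using assms(2) by (intro integral_completion) simp
  finally show ?thesis .
qed

text \<open>The product of \<open>u\<close> and the test function vanishes off a compact subset of
  \<open>\<Omega>\<close>, so it is differentiable on the whole space although \<open>u\<close> need
  not be, and its directional derivative integrates to 0. It is used for a function and its
  gradient, and again for the components of a gradient field.\<close>

lemma integration_by_parts:
  fixes u :: "'a::euclidean_space \<Rightarrow> real"
  assumes \<Omega>: "open \<Omega>" and \<phi>: "test_function \<Omega> \<phi>"
    and u: "\<And>x. x \<in> \<Omega> \<Longrightarrow> (u has_derivative (\<lambda>h. g x \<bullet> h)) (at x)"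
    and g: "continuous_on \<Omega> g"
  shows "(LINT x|lebesgue_on \<Omega>. u x * (classical_grad \<phi> x \<bullet> b)) =
    - (LINT x|lebesgue_on \<Omega>. (g x \<bullet> b) * \<phi> x)"
proof -
  define K where "K = closure {x. \<phi> x \<noteq> 0}"
  have K: "compact K" "K \<subseteq> \<Omega>" using \<phi> by (auto simp: test_function_def K_def)
  note out = test_function_outside[OF \<phi>, folded K_def]
  have cu: "continuous_on \<Omega> u"
    by (rule has_derivative_continuous_on[OF has_derivative_at_withinI[OF u]])
  define F1 where "F1 x = u x * (classical_grad \<phi> x \<bullet> b)" for x
  define F2 where "F2 x = (g x \<bullet> b) * \<phi> x" for x
  have F_cont: "continuous_on \<Omega> F1" "continuous_on \<Omega> F2"
    unfolding F1_def F2_def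
    by (intro continuous_intros cu g classical_grad_continuous[OF \<phi>] test_function_continuous[OF \<phi>])+
  have F_out: "F1 x = 0" "F2 x = 0" if "x \<notin> K" for x
    using out[OF that] by (simp_all add: F1_def F2_def)
  \<comment> \<open>Gluing: \<open>\<Omega>\<close> and the complement of \<open>K\<close> are open
    and cover the space, and the function is 0 on the latter.\<close>
  have cont: "continuous_on UNIV F" if "continuous_on \<Omega> F" "\<And>x. x \<notin> K \<Longrightarrow> F x = 0" for F :: "'a \<Rightarrow> real"
  proof -
    have "continuous_on (- K) F \<longleftrightarrow> continuous_on (- K) (\<lambda>_. 0 :: real)"
      by (rule continuous_on_cong) (simp_all add: that(2))
    then have "continuous_on (\<Omega> \<union> - K) F"
      by (intro continuous_on_open_Un \<Omega> that(1)) (simp_all add: open_Compl compact_imp_closed K(1))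
    moreover have "\<Omega> \<union> - K = UNIV" using K by auto
    ultimately show ?thesis by simp
  qed
  have cF: "continuous_on UNIV F1" "continuous_on UNIV F2"
    by (rule cont[OF F_cont(1) F_out(1)], assumption, rule cont[OF F_cont(2) F_out(2)], assumption)
  have int: "integrable lborel F1" "integrable lborel F2"
  proof -
    have eq: "(\<lambda>x. indicator K x *\<^sub>R F1 x) = F1" "(\<lambda>x. indicator K x *\<^sub>R F2 x) = F2"
      by (rule ext, case_tac "x \<in> K", simp, simp add: F_out)+
    show "integrable lborel F1" "integrable lborel F2"
      using borel_integrable_compact[OF K(1) continuous_on_subset[OF cF(1)]]
        borel_integrable_compact[OF K(1) continuous_on_subset[OF cF(2)]]
      unfolding eq by auto
  qed
  define F where "F x h = u x * (classical_grad \<phi> x \<bullet> h) + (g x \<bullet> h) * \<phi> x" for x h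
  have deriv: "((\<lambda>x. u x * \<phi> x) has_derivative F x) (at x)" for x
  proof (cases "x \<in> \<Omega>")
    case True
    show ?thesis
      using has_derivative_mult[OF u[OF True] has_derivative_classical_grad[OF \<phi>]]
      by (simp add: F_def[abs_def])
  next
    case False
    then have x: "x \<notin> K" using K by auto
    have "((\<lambda>x. 0) has_derivative (\<lambda>h. 0)) (at x)" by simp
    then have "((\<lambda>x. u x * \<phi> x) has_derivative (\<lambda>h. 0)) (at x)"
      by (rule has_derivative_transform_within_open[where s = "- K"])
        (use x out K(1) in \<open>auto simp: open_Compl compact_imp_closed\<close>)
    moreover have "F x = (\<lambda>h. 0)"
      using out[OF x] by (simp add: F_def[abs_def])
    ultimately show ?thesis by simp
  qed
  have Fb: "F x b = F1 x + F2 x" for x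
    by (simp add: F_def F1_def F2_def)
  have "continuous_on K (\<lambda>x. F x b)"
    unfolding Fb
    by (intro continuous_on_add continuous_on_subset[OF cF(1)] continuous_on_subset[OF cF(2)]) auto
  then have "bounded ((\<lambda>x. F x b) ` K)"
    using K(1) by (intro compact_imp_bounded compact_continuous_image)
  then obtain C where C: "C > 0" "\<And>x. x \<in> K \<Longrightarrow> \<bar>F x b\<bar> \<le> C"
    unfolding bounded_pos by auto
  have bd: "\<bar>F x b\<bar> \<le> C" for x
    using C F_out[of x] by (cases "x \<in> K") (auto simp: Fb)
  have "(LINT x|lborel. F x b) = 0"
    by (rule integral_directional_derivative_eq_0[OF deriv bd, where S = K])
      (simp_all add: compact_imp_bounded K(1) out(1))
  then have "(LINT x|lborel. F1 x) + (LINT x|lborel. F2 x) = 0"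
    using int by (simp add: Fb)
  moreover have "(LINT x|lebesgue_on \<Omega>. F1 x) = (LINT x|lborel. F1 x)"
    "(LINT x|lebesgue_on \<Omega>. F2 x) = (LINT x|lborel. F2 x)"
    using cF F_out K
    by (intro integral_lebesgue_on_eq_lborel \<Omega> borel_measurable_continuous_onI; blast)+
  ultimately show ?thesis
    unfolding F1_def F2_def by linarith
qed

text \<open>A smooth approximation of the indicator of an open box: the product is positive exactly
  inside, and the factor n drives it to infinity there, where \<open>bump 0\<close> tends to 1. For
  n = 0 the function is identically 0, which is why \<open>Suc n\<close> appears below.\<close>

definition box_bump :: "'a::euclidean_space \<Rightarrow> 'a \<Rightarrow> nat \<Rightarrow> 'a \<Rightarrow> real" where
  "box_bump a c n x =
     bump 0 (real n * (\<Prod>b\<in>Basis. bump 0 (x \<bullet> b - a \<bullet> b) * bump 0 (c \<bullet> b - x \<bullet> b)))"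

lemma box_bump_pos_iff: "0 < box_bump a c (Suc n) x \<longleftrightarrow> x \<in> box a c"
proof -
  let ?p = "\<lambda>b. bump 0 (x \<bullet> b - a \<bullet> b) * bump 0 (c \<bullet> b - x \<bullet> b)"
  have nn: "0 \<le> ?p b" for b by (simp add: bump_nonneg)
  have p: "?p b \<noteq> 0 \<longleftrightarrow> a \<bullet> b < x \<bullet> b \<and> x \<bullet> b < c \<bullet> b" for b
    using bump_pos_iff[of 0 "x \<bullet> b - a \<bullet> b"] bump_pos_iff[of 0 "c \<bullet> b - x \<bullet> b"]
      bump_nonneg[of 0 "x \<bullet> b - a \<bullet> b"] bump_nonneg[of 0 "c \<bullet> b - x \<bullet> b"]
    by (auto simp: less_le)
  have "0 < box_bump a c (Suc n) x \<longleftrightarrow> 0 < (\<Prod>b\<in>Basis. ?p b)"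
    by (simp add: box_bump_def bump_pos_iff zero_less_mult_iff)
  also have "\<dots> \<longleftrightarrow> (\<Prod>b\<in>Basis. ?p b) \<noteq> 0"
    using prod_nonneg[of Basis ?p] nn by (simp add: less_le)
  also have "\<dots> \<longleftrightarrow> (\<forall>b\<in>Basis. ?p b \<noteq> 0)" by simp
  finally show ?thesis unfolding p mem_box .
qed

lemma box_bump_bounds: "0 \<le> box_bump a c n x" "box_bump a c n x \<le> 1"
  by (simp_all add: box_bump_def bump_nonneg bump_0_le_1)

lemma box_bump_outside: "x \<notin> box a c \<Longrightarrow> box_bump a c (Suc n) x = 0"
  using box_bump_pos_iff[of a c n x] box_bump_bounds(1)[of a c "Suc n" x] by linarith

lemma box_bump_tendsto: "(\<lambda>n. box_bump a c (Suc n) x) \<longlonglongrightarrow> indicator (box a c) x"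
proof (cases "x \<in> box a c")
  case True
  let ?P = "\<Prod>b\<in>Basis. bump 0 (x \<bullet> b - a \<bullet> b) * bump 0 (c \<bullet> b - x \<bullet> b)"
  have "?P > 0"
    using True box_bump_pos_iff[of a c 0 x] by (simp add: box_bump_def bump_pos_iff)
  then have "filterlim (\<lambda>n. real (Suc n) * ?P) at_top sequentially"
    by (intro filterlim_at_top_mult_tendsto_pos[OF tendsto_const]
        filterlim_compose[OF filterlim_real_sequentially filterlim_Suc])
      simp_all
  from filterlim_compose[OF bump_tendsto_at_top(1) this] show ?thesis
    using True by (simp add: box_bump_def)
qed (simp add: box_bump_outside)

lemma test_function_box_bump:
  assumes "cbox a c \<subseteq> \<Omega>"
  shows "test_function \<Omega> (box_bump a c (Suc n))"
proof (rule test_functionI)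
  show "C_k k (box_bump a c (Suc n))" for k
    unfolding box_bump_def[abs_def]
    by (intro C_k_comp[OF C_k_bump] C_k_mult[OF C_k_const] C_k_prod C_k_mult C_k_diff
        C_k_const C_k_inner)
  show "{x. box_bump a c (Suc n) x \<noteq> 0} \<subseteq> cbox a c"
    using box_bump_outside box_subset_cbox by blast
qed (use assms in auto)

text \<open>Serves twice: it makes the set in \<open>first_eigenvalue\<close> nonempty, and it
  provides the fixed trial function on the unit ball.\<close>

lemma ex_test_function:
  assumes "open \<Omega>" "\<Omega> \<noteq> {}"
  obtains \<phi> where "test_function \<Omega> \<phi>" "\<not> (AE x in lebesgue_on \<Omega>. \<phi> x = 0)"
proof -
  obtain x e where x: "e > 0" "ball x e \<subseteq> \<Omega>"
    using assms by (meson openE ex_in_conv)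
  obtain a c where ac: "x \<in> box a c" "cbox a c \<subseteq> ball x e"
    using x by (metis open_contains_cbox open_ball centre_in_ball)
  show ?thesis
  proof
    show "test_function \<Omega> (box_bump a c (Suc 0))"
      using ac x by (intro test_function_box_bump) auto
    show "\<not> (AE x in lebesgue_on \<Omega>. box_bump a c (Suc 0) x = 0)"
    proof
      assume "AE x in lebesgue_on \<Omega>. box_bump a c (Suc 0) x = 0"
      then have "AE x in lebesgue. x \<in> \<Omega> \<longrightarrow> box_bump a c (Suc 0) x = 0"
        using assms by (simp add: AE_restrict_space_iff)
      then have "AE x in lebesgue. x \<notin> box a c"
        by (rule AE_mp) (use ac x box_bump_pos_iff[of a c 0] box_subset_cbox[of a c] in
            \<open>fastforce intro!: AE_I2\<close>)
      then have "box a c \<in> null_sets lebesgue"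
        by (simp add: AE_iff_null_sets)
      then have "box a c = {}"
        using open_not_negligible[OF open_box] by (auto simp: negligible_iff_null_sets)
      then show False using ac by auto
    qed
  qed
qed

text \<open>The fundamental lemma of the calculus of variations. Smooth approximations of indicators
  show that the integral over every box inside \<open>\<Omega>\<close> vanishes; Lebesgue
  differentiation along shrinking cubes then recovers the values of \<open>f\<close> off a null
  set.\<close>

lemma AE_eq_0_if_integral_test_function_eq_0:
  fixes f :: "'a::euclidean_space \<Rightarrow> real"
  assumes \<Omega>: "open \<Omega>" and f: "integrable (lebesgue_on \<Omega>) f"
    and zero: "\<And>\<phi>. test_function \<Omega> \<phi> \<Longrightarrow> (LINT x|lebesgue_on \<Omega>. f x * \<phi> x) = 0"
  shows "AE x in lebesgue_on \<Omega>. f x = 0"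
proof -
  define F where "F x = indicator \<Omega> x *\<^sub>R f x" for x
  have F: "integrable lebesgue F"
    using f \<Omega> by (simp add: F_def[abs_def] integrable_restrict_space)
  have set_int: "set_integrable lebesgue A F" if "A \<in> sets lebesgue" for A
    unfolding set_integrable_def using integrable_mult_indicator[OF that F] .
  have box0: "integral (cbox a c) F = 0" if "cbox a c \<subseteq> \<Omega>" for a c
  proof -
    have [measurable]: "f \<in> borel_measurable (lebesgue_on \<Omega>)" using f by simp
    have [measurable]: "(\<lambda>x. box_bump a c (Suc n) x) \<in> borel_measurable (lebesgue_on \<Omega>)" for n
      using test_function_continuous[OF test_function_box_bump[OF that]] \<Omega>
      by (intro continuous_imp_measurable_on_sets_lebesgue) auto
    have "indicat_real (box a c) \<in> borel_measurable lebesgue"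
      by (intro borel_measurable_indicator) simp
    then have [measurable]: "indicat_real (box a c) \<in> borel_measurable (lebesgue_on \<Omega>)"
      by (rule measurable_restrict_space1)
    have "(\<lambda>n. LINT x|lebesgue_on \<Omega>. f x * box_bump a c (Suc n) x) \<longlonglongrightarrow>
        (LINT x|lebesgue_on \<Omega>. f x * indicator (box a c) x)"
    proof (rule integral_dominated_convergence[where w = "\<lambda>x. \<bar>f x\<bar>"])
      show "AE x in lebesgue_on \<Omega>. norm (f x * box_bump a c (Suc n) x) \<le> \<bar>f x\<bar>" for n
        by (auto simp: abs_mult box_bump_bounds mult_left_le)
    qed (use f in \<open>auto intro!: tendsto_intros box_bump_tendsto\<close>)
    then have "(LINT x|lebesgue_on \<Omega>. f x * indicator (box a c) x) = 0"
      using zero[OF test_function_box_bump[OF that]] by (simp add: LIMSEQ_const_iff)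
    then have "(LINT x:box a c|lebesgue. F x) = 0"
      using \<Omega> by (simp add: integral_restrict_space set_lebesgue_integral_def F_def mult_ac)
    then show ?thesis
      using set_lebesgue_integral_eq_integral(2)[OF set_int[of "box a c"]]
      by (simp add: integral_open_interval)
  qed
  have "F integrable_on cbox a c" for a c
    using set_lebesgue_integral_eq_integral(1)[OF set_int[of "cbox a c"]] by simp
  then obtain N where N: "negligible N"
    "\<And>x e. \<lbrakk>x \<notin> N; 0 < e\<rbrakk> \<Longrightarrow> \<exists>d>0. \<forall>h. 0 < h \<and> h < d \<longrightarrow>
        norm (integral (cbox x (x + h *\<^sub>R One)) F /\<^sub>R h ^ DIM('a) - F x) < e"
    using integrable_ccontinuous_explicit[of F] by blast
  have "f x = 0" if "x \<in> \<Omega>" "x \<notin> N" for x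
  proof (rule ccontr)
    assume "f x \<noteq> 0"
    then have "norm (F x) > 0" using that by (simp add: F_def)
    then obtain d where d: "d > 0" "\<And>h. 0 < h \<Longrightarrow> h < d \<Longrightarrow>
        norm (integral (cbox x (x + h *\<^sub>R One)) F /\<^sub>R h ^ DIM('a) - F x) < norm (F x)"
      using N(2)[OF \<open>x \<notin> N\<close>] by blast
    obtain e where e: "e > 0" "cball x e \<subseteq> \<Omega>"
      using \<Omega> \<open>x \<in> \<Omega>\<close> open_contains_cball by blast
    \<comment> \<open>The half keeps \<open>h\<close> strictly below \<open>d\<close>. The division
      by the dimension puts the cube with corner x and side \<open>h\<close> inside the ball, since
      the Euclidean norm is at most the sum of the absolute coordinates.\<close>
    define h where "h = min (d / 2) (e / DIM('a))"
    have h: "0 < h" "h < d" "h * DIM('a) \<le> e"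
      using d e by (auto simp: h_def field_simps min_def)
    have "cbox x (x + h *\<^sub>R One) \<subseteq> cball x e"
    proof
      fix y assume y: "y \<in> cbox x (x + h *\<^sub>R One)"
      have "norm (y - x) \<le> (\<Sum>b\<in>Basis. \<bar>(y - x) \<bullet> b\<bar>)" by (rule norm_le_l1)
      also have "\<dots> \<le> (\<Sum>b\<in>(Basis::'a set). h)"
        using y by (intro sum_mono) (auto simp: mem_box inner_diff_left inner_add_left)
      also have "\<dots> \<le> e" using h by (simp add: mult.commute)
      finally show "y \<in> cball x e" by (simp add: dist_norm norm_minus_commute)
    qed
    then have "integral (cbox x (x + h *\<^sub>R One)) F = 0"
      using e box0 by blast
    then show False using d(2)[OF h(1,2)] by simp
  qed
  moreover have "N \<in> null_sets lebesgue" using N(1) by (simp add: negligible_iff_null_sets)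
  ultimately have "AE x in lebesgue. x \<in> \<Omega> \<longrightarrow> f x = 0"
    by (intro AE_I'[of N]) auto
  then show ?thesis using \<Omega> by (simp add: AE_restrict_space_iff)
qed

section \<open>Weak gradients, the first eigenvalue and the torsional rigidity\<close>

lemma classical_grad_eqI:
  assumes "(\<phi> has_derivative (\<lambda>h. v \<bullet> h)) (at x)"
  shows "classical_grad \<phi> x = v"
proof -
  have "frechet_derivative \<phi> (at x) = (\<lambda>h. v \<bullet> h)"
    using frechet_derivative_at[OF assms] by simp
  then show ?thesis
    by (simp add: classical_grad_def euclidean_representation)
qed

lemma lmeasurable_openI: "open \<Omega> \<Longrightarrow> emeasure lebesgue \<Omega> < \<infinity> \<Longrightarrow> \<Omega> \<in> lmeasurable"
  by (simp add: fmeasurable_def)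

section \<open>Square integrability on sets of finite measure\<close>

lemma integrable_lebesgue_on_bounded:
  fixes f :: "'a::euclidean_space \<Rightarrow> 'b::euclidean_space"
  assumes "\<Omega> \<in> lmeasurable" "f \<in> borel_measurable (lebesgue_on \<Omega>)"
    and "\<And>x. x \<in> \<Omega> \<Longrightarrow> norm (f x) \<le> B"
  shows "integrable (lebesgue_on \<Omega>) f"
proof (rule finite_measure.integrable_const_bound[OF finite_measure_lebesgue_on])
  show "AE x in lebesgue_on \<Omega>. norm (f x) \<le> B"
    using assms(3) by (intro AE_I2) simp
qed (use assms in auto)

lemma integrable_mult_bounded:
  fixes f :: "'a::euclidean_space \<Rightarrow> real"
  assumes "integrable M f" "h \<in> borel_measurable M"
    and "\<And>x. x \<in> space M \<Longrightarrow> \<bar>h x\<bar> \<le> B"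
  shows "integrable M (\<lambda>x. f x * h x)"
proof (rule Bochner_Integration.integrable_bound[where f="\<lambda>x. B * f x"])
  show "AE x in M. norm (f x * h x) \<le> norm (B * f x)"
  proof (rule AE_I2)
    fix x assume x: "x \<in> space M"
    then have "\<bar>h x\<bar> \<le> \<bar>B\<bar>" using assms(3)[of x] by linarith
    then show "norm (f x * h x) \<le> norm (B * f x)"
      using mult_left_mono[of "\<bar>h x\<bar>" "\<bar>B\<bar>" "\<bar>f x\<bar>"] by (simp add: abs_mult mult.commute)
  qed
  show "(\<lambda>x. f x * h x) \<in> borel_measurable M"
    using assms by (intro borel_measurable_times) auto
qed (use assms in simp)

lemma L2_on_bounded:
  fixes f :: "'a::euclidean_space \<Rightarrow> 'b::euclidean_space"
  assumes "\<Omega> \<in> lmeasurable" and f: "f \<in> borel_measurable (lebesgue_on \<Omega>)"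
    and B: "\<And>x. x \<in> \<Omega> \<Longrightarrow> norm (f x) \<le> B"
  shows "L2_on \<Omega> f"
proof -
  have "integrable (lebesgue_on \<Omega>) (\<lambda>x. (norm (f x))\<^sup>2)"
  proof (rule integrable_lebesgue_on_bounded[OF assms(1)])
    show "norm ((norm (f x))\<^sup>2) \<le> B\<^sup>2" if "x \<in> \<Omega>" for x
      using power_mono[OF B[OF that], of 2] by simp
  qed (use f in measurable)
  then show ?thesis using f by (simp add: L2_on_def)
qed

lemma L2_on_diff:
  fixes f g :: "'a::euclidean_space \<Rightarrow> 'b::euclidean_space"
  assumes "L2_on \<Omega> f" "L2_on \<Omega> g"
  shows "L2_on \<Omega> (\<lambda>x. f x - g x)"
proof -
  have [measurable]: "f \<in> borel_measurable (lebesgue_on \<Omega>)" "g \<in> borel_measurable (lebesgue_on \<Omega>)"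
    using assms by (auto simp: L2_on_def)
  have "integrable (lebesgue_on \<Omega>) (\<lambda>x. (norm (f x - g x))\<^sup>2)"
  proof (rule Bochner_Integration.integrable_bound)
    show "integrable (lebesgue_on \<Omega>) (\<lambda>x. 2 * (norm (f x))\<^sup>2 + 2 * (norm (g x))\<^sup>2)"
      using assms by (auto simp: L2_on_def)
    show "AE x in lebesgue_on \<Omega>. norm ((norm (f x - g x))\<^sup>2)
        \<le> norm (2 * (norm (f x))\<^sup>2 + 2 * (norm (g x))\<^sup>2)"
    proof (rule AE_I2)
      fix x
      have "(norm (f x - g x))\<^sup>2 \<le> (norm (f x) + norm (g x))\<^sup>2"
        by (intro power_mono norm_triangle_ineq4) simp
      also have "\<dots> \<le> 2 * (norm (f x))\<^sup>2 + 2 * (norm (g x))\<^sup>2"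
        using sum_squares_bound[of "norm (f x)" "norm (g x)"] by (simp add: power2_sum)
      finally show "norm ((norm (f x - g x))\<^sup>2) \<le> norm (2 * (norm (f x))\<^sup>2 + 2 * (norm (g x))\<^sup>2)"
        by simp
    qed
  qed measurable
  then show ?thesis by (simp add: L2_on_def)
qed

text \<open>From e t <= e^2 + t^2 with t the norm of \<open>f x\<close>. The free parameter
  \<open>e\<close> makes convergence in the square norm imply convergence in mean: the second term
  vanishes for fixed \<open>e\<close>, and afterwards \<open>e\<close> is sent to 0.\<close>

lemma L2_on_integral_norm_le:
  fixes f :: "'a::euclidean_space \<Rightarrow> 'b::euclidean_space"
  assumes \<Omega>: "\<Omega> \<in> lmeasurable" and f: "L2_on \<Omega> f"
  shows "integrable (lebesgue_on \<Omega>) f"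
    and "e > 0 \<Longrightarrow> (LINT x|lebesgue_on \<Omega>. norm (f x))
      \<le> e * measure lebesgue \<Omega> + (LINT x|lebesgue_on \<Omega>. (norm (f x))\<^sup>2) / e"
proof -
  have le: "norm (f x) \<le> e + (norm (f x))\<^sup>2 / e" if "e > 0" for e x
  proof -
    have "2 * (e * norm (f x)) \<le> e\<^sup>2 + (norm (f x))\<^sup>2"
      using sum_squares_bound[of e "norm (f x)"] by simp
    moreover have "0 \<le> e * norm (f x)" using that by simp
    ultimately have "e * norm (f x) \<le> e\<^sup>2 + (norm (f x))\<^sup>2" by linarith
    then show ?thesis using that by (simp add: field_simps power2_eq_square)
  qed
  have int: "integrable (lebesgue_on \<Omega>) (\<lambda>x. e + (norm (f x))\<^sup>2 / e)" for e
    using f by (intro Bochner_Integration.integrable_add integrable_divide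
        finite_measure.integrable_const[OF finite_measure_lebesgue_on[OF \<Omega>]])
      (simp add: L2_on_def)
  have "AE x in lebesgue_on \<Omega>. norm (f x) \<le> norm (1 + (norm (f x))\<^sup>2 / 1)"
    by (rule AE_I2) (metis abs_ge_self le zero_less_one order_trans real_norm_def)
  then show f_int: "integrable (lebesgue_on \<Omega>) f"
    using f by (intro Bochner_Integration.integrable_bound[OF int[of 1]]) (auto simp: L2_on_def)
  assume e: "e > 0"
  have "(LINT x|lebesgue_on \<Omega>. norm (f x)) \<le> (LINT x|lebesgue_on \<Omega>. e + (norm (f x))\<^sup>2 / e)"
    using f_int int le[OF e] by (intro integral_mono) auto
  also have "\<dots> = e * measure lebesgue \<Omega> + (LINT x|lebesgue_on \<Omega>. (norm (f x))\<^sup>2) / e"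
    using f finite_measure.integrable_const[OF finite_measure_lebesgue_on[OF \<Omega>]] \<Omega>
    by (subst Bochner_Integration.integral_add)
      (auto simp: L2_on_def measure_restrict_space fmeasurableD mult.commute)
  finally show "(LINT x|lebesgue_on \<Omega>. norm (f x))
      \<le> e * measure lebesgue \<Omega> + (LINT x|lebesgue_on \<Omega>. (norm (f x))\<^sup>2) / e" .
qed

section \<open>Weak gradients and membership in \<open>H10\<close>\<close>

lemma has_weak_gradI:
  fixes u :: "'a::euclidean_space \<Rightarrow> real"
  assumes \<Omega>: "open \<Omega>" "\<Omega> \<in> lmeasurable"
    and u: "\<And>x. x \<in> \<Omega> \<Longrightarrow> (u has_derivative (\<lambda>h. g x \<bullet> h)) (at x)"
    and g: "continuous_on \<Omega> g"
    and B: "\<And>x. x \<in> \<Omega> \<Longrightarrow> \<bar>u x\<bar> \<le> B" "\<And>x. x \<in> \<Omega> \<Longrightarrow> norm (g x) \<le> B"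
  shows "has_weak_grad \<Omega> u g"
proof -
  have "continuous_on \<Omega> u"
    by (rule has_derivative_continuous_on[OF has_derivative_at_withinI[OF u]])
  then have "u \<in> borel_measurable (lebesgue_on \<Omega>)" "g \<in> borel_measurable (lebesgue_on \<Omega>)"
    using g \<Omega> by (auto intro: continuous_imp_measurable_on_sets_lebesgue)
  then have "L2_on \<Omega> u" "L2_on \<Omega> g"
    using B by (auto intro!: L2_on_bounded[OF \<Omega>(2)])
  then show ?thesis
    unfolding has_weak_grad_def using integration_by_parts[OF \<Omega>(1) _ u g] by blast
qed

lemma test_function_has_weak_grad:
  assumes \<Omega>: "open \<Omega>" "\<Omega> \<in> lmeasurable" and \<phi>: "test_function \<Omega> \<phi>"
  shows "has_weak_grad \<Omega> \<phi> (classical_grad \<phi>)"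
proof -
  obtain B1 B2 where B: "\<And>x. \<bar>\<phi> x\<bar> \<le> B1" "\<And>x. norm (classical_grad \<phi> x) \<le> B2"
    using test_function_bounded[OF \<phi>] by (auto simp: bounded_iff)
  show ?thesis
  proof (rule has_weak_gradI[OF \<Omega>, where B = "max B1 B2"])
    show "\<bar>\<phi> x\<bar> \<le> max B1 B2" "norm (classical_grad \<phi> x) \<le> max B1 B2" for x
      using B[of x] by linarith+
  qed (use has_derivative_classical_grad[OF \<phi>] classical_grad_continuous[OF \<phi>] in auto)
qed

text \<open>Each coordinate of the difference is orthogonal to all test functions. This uniqueness
  is what gives control over the choice made in \<open>weak_grad\<close>.\<close>

lemma has_weak_grad_unique:
  assumes \<Omega>: "open \<Omega>" "\<Omega> \<in> lmeasurable"
    and g: "has_weak_grad \<Omega> u g" and g': "has_weak_grad \<Omega> u g'"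
  shows "AE x in lebesgue_on \<Omega>. g x = g' x"
proof -
  have L2: "L2_on \<Omega> g" "L2_on \<Omega> g'"
    using g g' by (auto simp: has_weak_grad_def)
  have "AE x in lebesgue_on \<Omega>. (g x - g' x) \<bullet> b = 0" if b: "b \<in> Basis" for b
  proof (rule AE_eq_0_if_integral_test_function_eq_0[OF \<Omega>(1)])
    have int: "integrable (lebesgue_on \<Omega>) (\<lambda>x. g x \<bullet> b)" "integrable (lebesgue_on \<Omega>) (\<lambda>x. g' x \<bullet> b)"
      using L2_on_integral_norm_le(1)[OF \<Omega>(2)] L2 by auto
    then show "integrable (lebesgue_on \<Omega>) (\<lambda>x. (g x - g' x) \<bullet> b)"
      by (simp add: inner_diff_left)
    fix \<phi> assume \<phi>: "test_function \<Omega> \<phi>"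
    obtain B where B: "\<And>x. \<bar>\<phi> x\<bar> \<le> B"
      using test_function_bounded(1)[OF \<phi>] by (auto simp: bounded_iff)
    have meas: "\<phi> \<in> borel_measurable (lebesgue_on \<Omega>)"
      using \<Omega>(1) by (intro continuous_imp_measurable_on_sets_lebesgue test_function_continuous[OF \<phi>]) simp
    have "integrable (lebesgue_on \<Omega>) (\<lambda>x. (g x \<bullet> b) * \<phi> x)"
      "integrable (lebesgue_on \<Omega>) (\<lambda>x. (g' x \<bullet> b) * \<phi> x)"
      by (rule integrable_mult_bounded[OF int(1) meas], rule B,
          rule integrable_mult_bounded[OF int(2) meas], rule B)
    then have "(LINT x|lebesgue_on \<Omega>. (g x - g' x) \<bullet> b * \<phi> x) =
        (LINT x|lebesgue_on \<Omega>. (g x \<bullet> b) * \<phi> x) - (LINT x|lebesgue_on \<Omega>. (g' x \<bullet> b) * \<phi> x)"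
      by (simp add: inner_diff_left left_diff_distrib)
    also have "\<dots> = 0"
    proof -
      have "(LINT x|lebesgue_on \<Omega>. u x * (classical_grad \<phi> x \<bullet> b)) = - (LINT x|lebesgue_on \<Omega>. (g x \<bullet> b) * \<phi> x)"
        "(LINT x|lebesgue_on \<Omega>. u x * (classical_grad \<phi> x \<bullet> b)) = - (LINT x|lebesgue_on \<Omega>. (g' x \<bullet> b) * \<phi> x)"
        using g g' \<phi> b unfolding has_weak_grad_def by blast+
      then show ?thesis by linarith
    qed
    finally show "(LINT x|lebesgue_on \<Omega>. (g x - g' x) \<bullet> b * \<phi> x) = 0" .
  qed
  then have "AE x in lebesgue_on \<Omega>. \<forall>b\<in>Basis. (g x - g' x) \<bullet> b = 0"
    by (intro AE_finite_allI) auto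
  then show ?thesis
    by eventually_elim (simp add: euclidean_eq_iff[of "g _"] inner_diff_left)
qed

lemma weak_grad_AE_eq:
  assumes \<Omega>: "open \<Omega>" "\<Omega> \<in> lmeasurable" and g: "has_weak_grad \<Omega> u g"
  shows "has_weak_grad \<Omega> u (weak_grad \<Omega> u)" "AE x in lebesgue_on \<Omega>. weak_grad \<Omega> u x = g x"
proof -
  show "has_weak_grad \<Omega> u (weak_grad \<Omega> u)"
    unfolding weak_grad_def using someI[of "has_weak_grad \<Omega> u", OF g] .
  from has_weak_grad_unique[OF \<Omega> this g] show "AE x in lebesgue_on \<Omega>. weak_grad \<Omega> u x = g x" .
qed

lemma has_weak_gradD:
  assumes "has_weak_grad \<Omega> u g"
  shows "u \<in> borel_measurable (lebesgue_on \<Omega>)" "g \<in> borel_measurable (lebesgue_on \<Omega>)"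
    "L2_on \<Omega> u" "L2_on \<Omega> g"
  using assms by (auto simp: has_weak_grad_def L2_on_def)

text \<open>Convergence can be tested with an explicit gradient, since the chosen
  \<open>weak_grad\<close> differs from it only on a null set.\<close>

lemma H10I:
  assumes \<Omega>: "open \<Omega>" "\<Omega> \<in> lmeasurable" and g: "has_weak_grad \<Omega> u g"
    and \<phi>: "\<And>n. test_function \<Omega> (\<phi> n)"
    and lim: "(\<lambda>n. (LINT x|lebesgue_on \<Omega>. (u x - \<phi> n x)\<^sup>2)
         + (LINT x|lebesgue_on \<Omega>. (norm (g x - classical_grad (\<phi> n) x))\<^sup>2)) \<longlonglongrightarrow> 0"
  shows "u \<in> H10 \<Omega>"
proof -
  note wg = weak_grad_AE_eq[OF \<Omega> g]
  have meas: "classical_grad (\<phi> n) \<in> borel_measurable (lebesgue_on \<Omega>)" for n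
    using has_weak_gradD(2)[OF test_function_has_weak_grad[OF \<Omega> \<phi>]] .
  have "(LINT x|lebesgue_on \<Omega>. (norm (weak_grad \<Omega> u x - classical_grad (\<phi> n) x))\<^sup>2) =
     (LINT x|lebesgue_on \<Omega>. (norm (g x - classical_grad (\<phi> n) x))\<^sup>2)" for n
  proof (rule integral_cong_AE)
    show "AE x in lebesgue_on \<Omega>. (norm (weak_grad \<Omega> u x - classical_grad (\<phi> n) x))\<^sup>2 =
       (norm (g x - classical_grad (\<phi> n) x))\<^sup>2"
      using wg(2) by eventually_elim simp
  qed (use has_weak_gradD(2)[OF wg(1)] has_weak_gradD(2)[OF g] meas[of n] in measurable)
  then show ?thesis
    unfolding H10_def H1_def using g \<phi> lim by (auto intro!: exI[of _ \<phi>])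
qed

lemma test_function_H10:
  assumes \<Omega>: "open \<Omega>" "\<Omega> \<in> lmeasurable" and \<phi>: "test_function \<Omega> \<phi>"
  shows "\<phi> \<in> H10 \<Omega>"
  by (rule H10I[OF \<Omega> test_function_has_weak_grad[OF \<Omega> \<phi>] \<phi>]) simp

section \<open>Bounds for the first eigenvalue\<close>

lemma integral_weak_grad_cong:
  assumes \<Omega>: "open \<Omega>" "\<Omega> \<in> lmeasurable" and g: "has_weak_grad \<Omega> u g"
  shows "(LINT x|lebesgue_on \<Omega>. (norm (weak_grad \<Omega> u x))\<^sup>2) = (LINT x|lebesgue_on \<Omega>. (norm (g x))\<^sup>2)"
proof (rule integral_cong_AE)
  show "AE x in lebesgue_on \<Omega>. (norm (weak_grad \<Omega> u x))\<^sup>2 = (norm (g x))\<^sup>2"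
    using weak_grad_AE_eq(2)[OF \<Omega> g] by eventually_elim simp
qed (use has_weak_gradD(2)[OF weak_grad_AE_eq(1)[OF \<Omega> g]] has_weak_gradD(2)[OF g] in measurable)

text \<open>All Rayleigh quotients are nonnegative, but the real \<open>Inf\<close> of an empty set
  is unspecified; a nontrivial test function rules this case out.\<close>

lemma first_eigenvalue_nonneg:
  assumes \<Omega>: "open \<Omega>" "\<Omega> \<in> lmeasurable" "\<Omega> \<noteq> {}"
  shows "0 \<le> first_eigenvalue \<Omega>"
proof -
  obtain \<phi> where \<phi>: "test_function \<Omega> \<phi>" "\<not> (AE x in lebesgue_on \<Omega>. \<phi> x = 0)"
    using ex_test_function \<Omega> by metis
  show ?thesis
    unfolding first_eigenvalue_def
    by (rule cInf_greatest) (use \<phi> test_function_H10[OF \<Omega>(1,2)] in auto)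
qed

text \<open>The quotient is written over \<open>lborel\<close> so that it depends on the test
  function alone; one constant then bounds the eigenvalues of all sets containing its
  support.\<close>

lemma first_eigenvalue_le:
  assumes \<Omega>: "open \<Omega>" "\<Omega> \<in> lmeasurable" and \<phi>: "test_function \<Omega> \<phi>"
    "\<not> (AE x in lebesgue_on \<Omega>. \<phi> x = 0)"
  shows "first_eigenvalue \<Omega> \<le>
    (LINT x|lborel. (norm (classical_grad \<phi> x))\<^sup>2) / (LINT x|lborel. (\<phi> x)\<^sup>2)"
proof -
  note out = test_function_outside[OF \<phi>(1)]
  have sub: "closure {x. \<phi> x \<noteq> 0} \<subseteq> \<Omega>" using \<phi>(1) by (simp add: test_function_def)
  have "first_eigenvalue \<Omega> \<le> (LINT x|lebesgue_on \<Omega>. (norm (weak_grad \<Omega> \<phi> x))\<^sup>2) /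
      (LINT x|lebesgue_on \<Omega>. (\<phi> x)\<^sup>2)"
    unfolding first_eigenvalue_def
  proof (rule cInf_lower)
    show "bdd_below {(LINT x|lebesgue_on \<Omega>. (norm (weak_grad \<Omega> u x))\<^sup>2) /
        (LINT x|lebesgue_on \<Omega>. (u x)\<^sup>2) |u. u \<in> H10 \<Omega> \<and> \<not> (AE x in lebesgue_on \<Omega>. u x = 0)}"
      by (rule bdd_belowI[where m=0]) auto
  qed (use \<phi> test_function_H10[OF \<Omega>] in blast)
  also have "(LINT x|lebesgue_on \<Omega>. (norm (weak_grad \<Omega> \<phi> x))\<^sup>2) =
      (LINT x|lebesgue_on \<Omega>. (norm (classical_grad \<phi> x))\<^sup>2)"
    by (rule integral_weak_grad_cong[OF \<Omega> test_function_has_weak_grad[OF \<Omega> \<phi>(1)]])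
  also have "\<dots> = (LINT x|lborel. (norm (classical_grad \<phi> x))\<^sup>2)"
  proof (rule integral_lebesgue_on_eq_lborel[OF \<Omega>(1)])
    show "(\<lambda>x. (norm (classical_grad \<phi> x))\<^sup>2) \<in> borel_measurable borel"
      using borel_measurable_continuous_onI[OF classical_grad_continuous[OF \<phi>(1)]] by measurable
    show "(norm (classical_grad \<phi> x))\<^sup>2 = 0" if "x \<notin> \<Omega>" for x
      using out(2)[of x] sub that by auto
  qed
  also have "(LINT x|lebesgue_on \<Omega>. (\<phi> x)\<^sup>2) = (LINT x|lborel. (\<phi> x)\<^sup>2)"
  proof (rule integral_lebesgue_on_eq_lborel[OF \<Omega>(1)])
    show "(\<lambda>x. (\<phi> x)\<^sup>2) \<in> borel_measurable borel"
      using borel_measurable_continuous_onI[OF test_function_continuous[OF \<phi>(1)]] by measurable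
    show "(\<phi> x)\<^sup>2 = 0" if "x \<notin> \<Omega>" for x
    proof -
      have "x \<notin> closure {x. \<phi> x \<noteq> 0}" using sub that by blast
      from out(1)[OF this] show ?thesis by (simp only: power_zero_numeral)
    qed
  qed
  finally show ?thesis .
qed

text \<open>A density argument: the defect of the weak equation vanishes on test functions and is
  continuous along their convergence to \<open>v\<close>, because \<open>g\<close> is bounded and,
  on a set of finite measure, convergence in the square norm implies convergence in mean.\<close>

lemma weak_torsion_solutionI:
  assumes \<Omega>: "open \<Omega>" "\<Omega> \<in> lmeasurable" and w: "w \<in> H10 \<Omega>" and g: "has_weak_grad \<Omega> w g"
    and bound: "\<And>x. x \<in> \<Omega> \<Longrightarrow> norm (g x) \<le> B"
    and test: "\<And>\<phi>. test_function \<Omega> \<phi> \<Longrightarrow>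
      (LINT x|lebesgue_on \<Omega>. g x \<bullet> classical_grad \<phi> x) = (LINT x|lebesgue_on \<Omega>. \<phi> x)"
  shows "weak_torsion_solution \<Omega> w"
  unfolding weak_torsion_solution_def
proof (intro conjI ballI)
  let ?M = "lebesgue_on \<Omega>"
  fix v assume v: "v \<in> H10 \<Omega>"
  define h where "h = weak_grad \<Omega> v"
  obtain h' where "has_weak_grad \<Omega> v h'" using v by (auto simp: H10_def H1_def)
  then have h: "has_weak_grad \<Omega> v h" using weak_grad_AE_eq(1)[OF \<Omega>] by (simp add: h_def)
  define a where "a \<phi> = (LINT x|?M. (v x - \<phi> x)\<^sup>2) + (LINT x|?M. (norm (h x - classical_grad \<phi> x))\<^sup>2)" for \<phi>
  obtain \<phi> where \<phi>: "\<And>n. test_function \<Omega> (\<phi> n)" and lim: "(\<lambda>n. a (\<phi> n)) \<longlonglongrightarrow> 0"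
    using v by (auto simp: H10_def a_def h_def)
  \<comment> \<open>The maximum with 1 lets one constant multiply both the gradient term and the
    zero-order term.\<close>
  define C where "C = max 1 B"
  have C: "C > 0" "C \<ge> 1" "\<And>x. x \<in> \<Omega> \<Longrightarrow> norm (g x) \<le> C"
    using bound by (auto simp: C_def le_max_iff_disj)
  have [measurable]: "g \<in> borel_measurable ?M" using has_weak_gradD[OF g] by simp
  have int_inner: "integrable ?M (\<lambda>x. g x \<bullet> k x)" "(\<integral>x. \<bar>g x \<bullet> k x\<bar> \<partial>?M) \<le> C * (\<integral>x. norm (k x) \<partial>?M)"
    if k: "L2_on \<Omega> k" for k
  proof -
    have [measurable]: "k \<in> borel_measurable ?M" using k by (simp add: L2_on_def)
    have le: "\<bar>g x \<bullet> k x\<bar> \<le> C * norm (k x)" if "x \<in> \<Omega>" for x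
      using Cauchy_Schwarz_ineq2[of "g x" "k x"] mult_right_mono[OF C(3)[OF that], of "norm (k x)"]
      by simp
    have int: "integrable ?M (\<lambda>x. C * norm (k x))"
      using L2_on_integral_norm_le(1)[OF \<Omega>(2) k] by simp
    show i: "integrable ?M (\<lambda>x. g x \<bullet> k x)"
    proof (rule Bochner_Integration.integrable_bound[OF int])
      show "AE x in ?M. norm (g x \<bullet> k x) \<le> norm (C * norm (k x))"
        using le C(1) by (intro AE_I2) (simp add: abs_mult)
    qed measurable
    have "(\<integral>x. \<bar>g x \<bullet> k x\<bar> \<partial>?M) \<le> (\<integral>x. C * norm (k x) \<partial>?M)"
      using le i int by (intro integral_mono) auto
    then show "(\<integral>x. \<bar>g x \<bullet> k x\<bar> \<partial>?M) \<le> C * (\<integral>x. norm (k x) \<partial>?M)" by simp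
  qed
  define D where "D = (LINT x|?M. g x \<bullet> h x) - (LINT x|?M. v x)"
  have est: "\<bar>D\<bar> \<le> C * (2 * e * measure lebesgue \<Omega> + a (\<phi> n) / e)" if e: "e > 0" for e n
  proof -
    have t: "has_weak_grad \<Omega> (\<phi> n) (classical_grad (\<phi> n))"
      by (rule test_function_has_weak_grad[OF \<Omega> \<phi>])
    have L2: "L2_on \<Omega> (\<lambda>x. h x - classical_grad (\<phi> n) x)" "L2_on \<Omega> (\<lambda>x. v x - \<phi> n x)"
      using has_weak_gradD(3,4)[OF t] has_weak_gradD(3,4)[OF h] by (auto intro: L2_on_diff)
    note i1 = L2_on_integral_norm_le(1)[OF \<Omega>(2) has_weak_gradD(3)[OF t]]
    note i2 = L2_on_integral_norm_le(1)[OF \<Omega>(2) has_weak_gradD(3)[OF h]]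
    have "(LINT x|?M. g x \<bullet> (h x - classical_grad (\<phi> n) x)) =
        (LINT x|?M. g x \<bullet> h x) - (LINT x|?M. \<phi> n x)"
      using int_inner(1)[OF has_weak_gradD(4)[OF h]] int_inner(1)[OF has_weak_gradD(4)[OF t]]
        test[OF \<phi>[of n]] by (simp add: inner_diff_right)
    moreover have "(LINT x|?M. v x - \<phi> n x) = (LINT x|?M. v x) - (LINT x|?M. \<phi> n x)"
      using i1 i2 by simp
    ultimately have "D = (LINT x|?M. g x \<bullet> (h x - classical_grad (\<phi> n) x)) - (LINT x|?M. v x - \<phi> n x)"
      by (simp add: D_def)
    then have "\<bar>D\<bar> \<le> (\<integral>x. \<bar>g x \<bullet> (h x - classical_grad (\<phi> n) x)\<bar> \<partial>?M) + (\<integral>x. \<bar>v x - \<phi> n x\<bar> \<partial>?M)"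
      using integral_abs_bound[of ?M "\<lambda>x. g x \<bullet> (h x - classical_grad (\<phi> n) x)"]
        integral_abs_bound[of ?M "\<lambda>x. v x - \<phi> n x"] by linarith
    also have "\<dots> \<le> C * (\<integral>x. norm (h x - classical_grad (\<phi> n) x) \<partial>?M) + C * (\<integral>x. \<bar>v x - \<phi> n x\<bar> \<partial>?M)"
    proof (rule add_mono[OF int_inner(2)[OF L2(1)]])
      have "0 \<le> (\<integral>x. \<bar>v x - \<phi> n x\<bar> \<partial>?M)" by simp
      then show "(\<integral>x. \<bar>v x - \<phi> n x\<bar> \<partial>?M) \<le> C * (\<integral>x. \<bar>v x - \<phi> n x\<bar> \<partial>?M)"
        using mult_right_mono[OF C(2)] by fastforce
    qed
    also have "\<dots> = C * ((\<integral>x. norm (h x - classical_grad (\<phi> n) x) \<partial>?M) + (\<integral>x. norm (v x - \<phi> n x) \<partial>?M))"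
      by (simp add: distrib_left)
    also have "\<dots> \<le> C * ((e * measure lebesgue \<Omega> + (LINT x|?M. (norm (h x - classical_grad (\<phi> n) x))\<^sup>2) / e)
        + (e * measure lebesgue \<Omega> + (LINT x|?M. (norm (v x - \<phi> n x))\<^sup>2) / e))"
      using C(1) L2_on_integral_norm_le(2)[OF \<Omega>(2) L2(1) e] L2_on_integral_norm_le(2)[OF \<Omega>(2) L2(2) e]
      by (intro mult_left_mono add_mono) auto
    also have "\<dots> = C * (2 * e * measure lebesgue \<Omega> + a (\<phi> n) / e)"
      by (simp add: a_def add_divide_distrib algebra_simps)
    finally show ?thesis .
  qed
  \<comment> \<open>The order of limits matters: n goes to infinity with \<open>e\<close> fixed,
    which removes the term divided by \<open>e\<close>; then \<open>e\<close> tends to 0 from the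
    right.\<close>
  have est2: "\<bar>D\<bar> \<le> C * (2 * e * measure lebesgue \<Omega>)" if e: "e > 0" for e
  proof -
    have "(\<lambda>n. C * (2 * e * measure lebesgue \<Omega> + a (\<phi> n) / e)) \<longlonglongrightarrow> C * (2 * e * measure lebesgue \<Omega> + 0 / e)"
      using e by (intro tendsto_intros lim) auto
    from LIMSEQ_le_const[OF this, of "\<bar>D\<bar>"] show ?thesis using est[OF e] by auto
  qed
  have "((\<lambda>e. C * (2 * e * measure lebesgue \<Omega>)) \<longlongrightarrow> C * (2 * 0 * measure lebesgue \<Omega>)) (at_right 0)"
    by (intro tendsto_intros)
  from tendsto_lowerbound[OF this, of "\<bar>D\<bar>"] have "D = 0"
    using est2 by (auto simp: eventually_at_filter)
  moreover have "(LINT x|?M. weak_grad \<Omega> w x \<bullet> weak_grad \<Omega> v x) = (LINT x|?M. g x \<bullet> h x)"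
  proof (rule integral_cong_AE)
    show "AE x in ?M. weak_grad \<Omega> w x \<bullet> weak_grad \<Omega> v x = g x \<bullet> h x"
      using weak_grad_AE_eq(2)[OF \<Omega> g] by eventually_elim (simp add: h_def)
    have [measurable]: "h \<in> borel_measurable ?M" using has_weak_gradD[OF h] by simp
    have [measurable]: "weak_grad \<Omega> w \<in> borel_measurable ?M"
      using has_weak_gradD[OF weak_grad_AE_eq(1)[OF \<Omega> g]] by simp
    show "(\<lambda>x. weak_grad \<Omega> w x \<bullet> weak_grad \<Omega> v x) \<in> borel_measurable ?M"
      unfolding h_def[symmetric] by measurable
    show "(\<lambda>x. g x \<bullet> h x) \<in> borel_measurable ?M" by measurable
  qed
  ultimately show "(LINT x|?M. weak_grad \<Omega> w x \<bullet> weak_grad \<Omega> v x) = (LINT x|?M. v x)"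
    by (simp add: D_def)
qed (rule w)

text \<open>Testing each of two solutions with the other shows that both have the same integral.\<close>

lemma torsional_rigidity_eq:
  assumes "weak_torsion_solution \<Omega> w"
  shows "torsional_rigidity \<Omega> = (LINT x|lebesgue_on \<Omega>. w x)"
proof -
  define t where "t = torsion_function \<Omega>"
  have t: "weak_torsion_solution \<Omega> t"
    unfolding t_def torsion_function_def using someI[of "weak_torsion_solution \<Omega>", OF assms] .
  have "(LINT x|lebesgue_on \<Omega>. t x) = (LINT x|lebesgue_on \<Omega>. weak_grad \<Omega> w x \<bullet> weak_grad \<Omega> t x)"
    using assms t by (simp add: weak_torsion_solution_def)
  also have "\<dots> = (LINT x|lebesgue_on \<Omega>. weak_grad \<Omega> t x \<bullet> weak_grad \<Omega> w x)"
    by (simp add: inner_commute)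
  also have "\<dots> = (LINT x|lebesgue_on \<Omega>. w x)"
    using assms t by (simp add: weak_torsion_solution_def)
  finally show ?thesis by (simp add: torsional_rigidity_def t_def)
qed

section \<open>The torsion function of a disjoint union of balls\<close>

text \<open>A smooth substitute for the positive part. Its derivative is
  \<open>bump 0 + bump 1\<close>, because the factor t cancels one power of 1/t in the derivative of
  \<open>bump 0\<close>.\<close>

definition ramp :: "real \<Rightarrow> real" where
  "ramp t = t * bump 0 t"

lemma ramp_has_derivative: "(ramp has_real_derivative bump 0 t + bump 1 t) (at t)"
proof -
  have "bump 0 t + t * bump 2 t = bump 0 t + bump 1 t"
    by (simp add: bump_def power2_eq_square)
  then show ?thesis
    unfolding ramp_def[abs_def]
    using DERIV_mult[OF DERIV_ident bump_has_derivative[of 0 t]]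
    by (auto elim!: DERIV_cong simp: algebra_simps numeral_2_eq_2)
qed

lemma C_k_ramp: "C_k k ramp"
  unfolding ramp_def[abs_def] by (intro C_k_mult C_k_id C_k_bump)

lemma DIM_ge_1: "1 \<le> real DIM('a::euclidean_space)"
  using DIM_positive[where 'a='a] by (simp add: Suc_leI)

lemma ramp_nonpos: "t \<le> 0 \<Longrightarrow> ramp t = 0"
  by (simp add: ramp_def bump_def)

lemma ramp_bounds: "0 \<le> ramp t" "0 \<le> t \<Longrightarrow> ramp t \<le> t"
  using bump_0_le_1[of t] bump_nonneg[of 0 t]
  by (auto simp: ramp_def bump_def mult_left_le)

text \<open>The cap on the radii makes 1 a common bound for the torsion function and its gradient,
  hence a dominating function in the limits below.\<close>

locale disjoint_balls =
  fixes I :: "nat set" and c :: "nat \<Rightarrow> 'a::euclidean_space" and r :: "nat \<Rightarrow> real"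
  assumes finite_I: "finite I"
    and r_pos: "\<And>i. i \<in> I \<Longrightarrow> 0 < r i"
    and r_le_1: "\<And>i. i \<in> I \<Longrightarrow> r i \<le> 1"
    and disj: "disjoint_family_on (\<lambda>i. ball (c i) (r i)) I"
begin

definition \<Omega> :: "'a set" where
  "\<Omega> = (\<Union>i\<in>I. ball (c i) (r i))"

definition p :: "nat \<Rightarrow> 'a \<Rightarrow> real" where
  "p i x = ((r i)\<^sup>2 - (x - c i) \<bullet> (x - c i)) / (2 * DIM('a))"

definition w :: "'a \<Rightarrow> real" where
  "w x = (\<Sum>i\<in>I. indicator (ball (c i) (r i)) x * p i x)"

definition g :: "'a \<Rightarrow> 'a" where
  "g x = (\<Sum>i\<in>I. indicator (ball (c i) (r i)) x *\<^sub>R ((- 1 / DIM('a)) *\<^sub>R (x - c i)))"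

text \<open>The derivative of \<^term>\<open>ramp\<close> is bounded and tends to 1 at infinity, hence
  \<open>approx n\<close> converges to \<^term>\<open>w\<close> together with its gradient; it vanishes near the boundary
  because \<open>ramp (t - 1) = 0\<close> for \<open>t \<le> 1\<close>.\<close>

definition approx :: "nat \<Rightarrow> 'a \<Rightarrow> real" where
  "approx n x = (\<Sum>i\<in>I. ramp (real (Suc n) * p i x - 1) / real (Suc n))"

section \<open>Pointwise description of \<open>w\<close> and its gradient\<close>

lemma open_\<Omega>: "open \<Omega>"
  by (auto simp: \<Omega>_def)

lemma lmeasurable_\<Omega>: "\<Omega> \<in> lmeasurable"
  unfolding \<Omega>_def using finite_I by (intro fmeasurable.finite_UN) auto

text \<open>The sign of the globally defined polynomial \<open>p i\<close> detects its ball, so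
  composing with \<open>ramp\<close> localizes to the ball smoothly, without any indicator.\<close>

lemma p_pos_iff:
  assumes "i \<in> I"
  shows "0 < p i x \<longleftrightarrow> x \<in> ball (c i) (r i)"
proof -
  have "0 < p i x \<longleftrightarrow> (norm (x - c i))\<^sup>2 < (r i)\<^sup>2"
    by (simp add: p_def zero_less_divide_iff dot_square_norm)
  also have "\<dots> \<longleftrightarrow> norm (x - c i) < r i"
    using r_pos[OF assms] by (meson norm_ge_zero not_le power2_le_imp_le power_mono less_le_not_le less_imp_le)
  finally show ?thesis by (simp add: dist_norm norm_minus_commute)
qed

lemma indicator_other:
  assumes "j \<in> I" "i \<in> I" "i \<noteq> j" "x \<in> ball (c j) (r j)"
  shows "x \<notin> ball (c i) (r i)"
  using disjoint_family_onD[OF disj assms(2,1,3)] assms(4) by blast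

lemma w_eq: "j \<in> I \<Longrightarrow> x \<in> ball (c j) (r j) \<Longrightarrow> w x = p j x"
  unfolding w_def using finite_I indicator_other
  by (subst sum.mono_neutral_right[of _ "{j}"]) (auto simp: indicator_def)

lemma g_eq: "j \<in> I \<Longrightarrow> x \<in> ball (c j) (r j) \<Longrightarrow> g x = (- 1 / DIM('a)) *\<^sub>R (x - c j)"
  unfolding g_def using finite_I indicator_other
  by (subst sum.mono_neutral_right[of _ "{j}"]) (auto simp: indicator_def)

lemma p_has_derivative: "(p i has_derivative (\<lambda>h. ((- 1 / DIM('a)) *\<^sub>R (x - c i)) \<bullet> h)) (at x)"
proof -
  have eq: "p i = (\<lambda>x. ((r i)\<^sup>2 - (x - c i) \<bullet> (x - c i)) * (1 / (2 * DIM('a))))"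
    by (intro ext) (simp add: p_def)
  have "((\<lambda>x. (x - c i) \<bullet> (x - c i)) has_derivative (\<lambda>h. (x - c i) \<bullet> h + h \<bullet> (x - c i))) (at x)"
    by (rule has_derivative_inner) (auto intro!: derivative_eq_intros)
  from has_derivative_mult_left[OF has_derivative_diff[OF has_derivative_const this], of _ "1 / (2 * DIM('a))"]
  show ?thesis
    unfolding eq
    by (rule has_derivative_eq_rhs, intro ext)
      (simp only: inner_commute[of _ "x - c i"] inner_scaleR_left, simp add: field_simps)
qed

lemma w_has_derivative:
  assumes "x \<in> \<Omega>"
  shows "(w has_derivative (\<lambda>h. g x \<bullet> h)) (at x)"
proof -
  obtain j where j: "j \<in> I" "x \<in> ball (c j) (r j)" using assms by (auto simp: \<Omega>_def)
  have "(w has_derivative (\<lambda>h. ((- 1 / DIM('a)) *\<^sub>R (x - c j)) \<bullet> h)) (at x)"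
    by (rule has_derivative_transform_within_open[OF p_has_derivative open_ball j(2)])
      (simp add: w_eq[OF j(1)])
  then show ?thesis by (simp only: g_eq[OF j])
qed

lemma g_has_derivative:
  assumes "x \<in> \<Omega>"
  shows "(g has_derivative (\<lambda>h. (- 1 / DIM('a)) *\<^sub>R h)) (at x)"
proof -
  obtain j where j: "j \<in> I" "x \<in> ball (c j) (r j)" using assms by (auto simp: \<Omega>_def)
  have "((\<lambda>x. (- 1 / DIM('a)) *\<^sub>R (x - c j)) has_derivative (\<lambda>h. (- 1 / DIM('a)) *\<^sub>R h)) (at x)"
    by (auto intro!: derivative_eq_intros)
  then show ?thesis
    by (rule has_derivative_transform_within_open[OF _ open_ball j(2)]) (simp add: g_eq[OF j(1)])
qed

lemma continuous_g: "continuous_on \<Omega> g"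
  by (rule has_derivative_continuous_on[OF has_derivative_at_withinI[OF g_has_derivative]])

lemma p_le: "p i x \<le> (r i)\<^sup>2"
proof -
  have "(r i)\<^sup>2 - (x - c i) \<bullet> (x - c i) \<le> (r i)\<^sup>2" by simp
  also have "\<dots> \<le> (r i)\<^sup>2 * (2 * DIM('a))"
    using mult_left_mono[of 1 "2 * real DIM('a)" "(r i)\<^sup>2"] DIM_ge_1[where 'a='a] by simp
  finally show ?thesis by (simp add: p_def divide_le_eq)
qed

lemma w_bounds:
  assumes "x \<in> \<Omega>"
  shows "0 \<le> w x" "w x \<le> 1" "norm (g x) \<le> 1"
proof -
  obtain j where j: "j \<in> I" "x \<in> ball (c j) (r j)" using assms by (auto simp: \<Omega>_def)
  show "0 \<le> w x"
    unfolding w_eq[OF j] using p_pos_iff[OF j(1)] j(2) by (intro less_imp_le) blast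
  have "(r j)\<^sup>2 \<le> 1"
    using r_pos[OF j(1)] r_le_1[OF j(1)] by (simp add: power_le_one)
  then show "w x \<le> 1" unfolding w_eq[OF j] using p_le[of j x] by linarith
  have "norm (x - c j) \<le> 1"
    using j(2) r_le_1[OF j(1)] by (simp add: dist_norm norm_minus_commute)
  then have "norm (x - c j) \<le> real DIM('a)" using DIM_ge_1[where 'a='a] by linarith
  then show "norm (g x) \<le> 1" unfolding g_eq[OF j] by (simp add: divide_le_eq)
qed

lemma has_weak_grad_w: "has_weak_grad \<Omega> w g"
  by (rule has_weak_gradI[OF open_\<Omega> lmeasurable_\<Omega> w_has_derivative continuous_g, where B=1])
    (use w_bounds in auto)

text \<open>The weak form of div g = -1. On every ball the derivative of \<open>g\<close> is -1/d
  times the identity, so integration by parts in each of the d coordinates yields one d-th of the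
  integral of the test function.\<close>

lemma integral_g_inner_grad:
  assumes \<phi>: "test_function \<Omega> \<phi>"
  shows "(LINT x|lebesgue_on \<Omega>. g x \<bullet> classical_grad \<phi> x) = (LINT x|lebesgue_on \<Omega>. \<phi> x)"
proof -
  let ?M = "lebesgue_on \<Omega>"
  let ?k = "- 1 / real DIM('a)"
  have by_parts: "(LINT x|?M. (g x \<bullet> b) * (classical_grad \<phi> x \<bullet> b)) = (LINT x|?M. \<phi> x) / DIM('a)"
    if b: "b \<in> Basis" for b
  proof -
    have "(LINT x|?M. (g x \<bullet> b) * (classical_grad \<phi> x \<bullet> b)) =
        - (LINT x|?M. ((?k *\<^sub>R b) \<bullet> b) * \<phi> x)"
    proof (rule integration_by_parts[OF open_\<Omega> \<phi>])
      show "((\<lambda>x. g x \<bullet> b) has_derivative (\<lambda>h. (?k *\<^sub>R b) \<bullet> h)) (at x)" if "x \<in> \<Omega>" for x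
        using has_derivative_inner_left[OF g_has_derivative[OF that], of b]
        by (simp add: inner_commute)
    qed simp
    then show ?thesis using b by simp
  qed
  obtain B where B: "\<And>x. norm (classical_grad \<phi> x) \<le> B"
    using test_function_bounded(2)[OF \<phi>] by (auto simp: bounded_iff)
  have int: "integrable ?M (\<lambda>x. (g x \<bullet> b) * (classical_grad \<phi> x \<bullet> b))" if b: "b \<in> Basis" for b
  proof (rule integrable_lebesgue_on_bounded[OF lmeasurable_\<Omega>])
    show "(\<lambda>x. (g x \<bullet> b) * (classical_grad \<phi> x \<bullet> b)) \<in> borel_measurable ?M"
      using open_\<Omega> by (intro continuous_imp_measurable_on_sets_lebesgue continuous_intros
          continuous_g classical_grad_continuous[OF \<phi>]) auto
    fix x assume x: "x \<in> \<Omega>"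
    have "\<bar>g x \<bullet> b\<bar> \<le> 1" "\<bar>classical_grad \<phi> x \<bullet> b\<bar> \<le> B"
      using Basis_le_norm[OF b, of "g x"] w_bounds(3)[OF x]
        Basis_le_norm[OF b, of "classical_grad \<phi> x"] B[of x] by linarith+
    then show "norm ((g x \<bullet> b) * (classical_grad \<phi> x \<bullet> b)) \<le> 1 * B"
      unfolding real_norm_def abs_mult by (intro mult_mono) auto
  qed
  have "(LINT x|?M. g x \<bullet> classical_grad \<phi> x) =
      (LINT x|?M. (\<Sum>b\<in>Basis. (g x \<bullet> b) * (classical_grad \<phi> x \<bullet> b)))"
    by (rule Bochner_Integration.integral_cong[OF refl euclidean_inner])
  also have "\<dots> = (\<Sum>b\<in>(Basis::'a set). (LINT x|?M. (g x \<bullet> b) * (classical_grad \<phi> x \<bullet> b)))"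
    using int by (rule Bochner_Integration.integral_sum)
  also have "\<dots> = (\<Sum>b\<in>(Basis::'a set). (LINT x|?M. \<phi> x) / DIM('a))"
    by (rule sum.cong[OF refl by_parts])
  finally show ?thesis by simp
qed

lemma test_function_approx: "test_function \<Omega> (approx n)"
proof (rule test_functionI)
  define K where "K = (\<Union>i\<in>I. {x. 1 / real (Suc n) \<le> p i x})"
  \<comment> \<open>In coordinates \<open>p i\<close> is a polynomial, which the closure rules for
    \<open>C_k\<close> can handle.\<close>
  have p_C: "C_k k (p i)" for k i
  proof -
    have "(x - c i) \<bullet> (x - c i) = (\<Sum>b\<in>Basis. (x \<bullet> b - c i \<bullet> b) * (x \<bullet> b - c i \<bullet> b))" for x
      by (subst euclidean_inner) (simp add: inner_diff_left)
    then have "p i = (\<lambda>x. ((r i)\<^sup>2 - (\<Sum>b\<in>Basis. (x \<bullet> b - c i \<bullet> b) * (x \<bullet> b - c i \<bullet> b))) * (1 / (2 * DIM('a))))"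
      by (intro ext) (simp add: p_def)
    then show ?thesis
      by (simp only:) (intro C_k_mult C_k_diff C_k_const C_k_sum C_k_inner)
  qed
  show "C_k k (approx n)" for k
    unfolding approx_def[abs_def] divide_inverse
    by (intro C_k_sum C_k_mult C_k_const C_k_comp[OF C_k_ramp] C_k_diff p_C)
  have sub: "{x. 1 / real (Suc n) \<le> p i x} \<subseteq> ball (c i) (r i)" if "i \<in> I" for i
  proof
    fix x assume "x \<in> {x. 1 / real (Suc n) \<le> p i x}"
    moreover have "0 < 1 / real (Suc n)" by simp
    ultimately have "0 < p i x" unfolding mem_Collect_eq by (rule less_le_trans[rotated])
    then show "x \<in> ball (c i) (r i)" using p_pos_iff[OF that] by blast
  qed
  have "compact {x. 1 / real (Suc n) \<le> p i x}" if "i \<in> I" for i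
    unfolding compact_eq_bounded_closed
  proof
    show "bounded {x. 1 / real (Suc n) \<le> p i x}"
      using bounded_subset[OF bounded_ball sub[OF that]] .
    show "closed {x. 1 / real (Suc n) \<le> p i x}"
      using C_k_continuous[OF p_C] by (intro closed_Collect_le continuous_on_const)
  qed
  then show "compact K" unfolding K_def using finite_I by (intro compact_UN) auto
  show "K \<subseteq> \<Omega>" unfolding K_def \<Omega>_def using sub by blast
  show "{x. approx n x \<noteq> 0} \<subseteq> K"
  proof (intro subsetI, rule ccontr)
    fix x assume x: "x \<in> {x. approx n x \<noteq> 0}" "x \<notin> K"
    have "ramp (real (Suc n) * p i x - 1) = 0" if "i \<in> I" for i
    proof (rule ramp_nonpos)
      have "p i x < 1 / real (Suc n)" using x(2) that by (auto simp: K_def not_le)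
      then show "real (Suc n) * p i x - 1 \<le> 0" by (simp add: field_simps)
    qed
    then have "approx n x = 0" by (simp add: approx_def)
    with x(1) show False by simp
  qed
qed

text \<open>Off its own ball every \<open>p i\<close> is nonpositive, so only one summand survives.
  The inner factor \<open>Suc n\<close> from the chain rule cancels the division, which leaves a
  multiple of \<open>g\<close> with a factor bounded independently of n.\<close>

lemma approx_on_ball:
  assumes j: "j \<in> I" "x \<in> ball (c j) (r j)"
  shows "approx n x = ramp (real (Suc n) * p j x - 1) / real (Suc n)"
    and "classical_grad (approx n) x =
      (bump 0 (real (Suc n) * p j x - 1) + bump 1 (real (Suc n) * p j x - 1)) *\<^sub>R g x"
proof -
  have eq: "approx n y = ramp (real (Suc n) * p j y - 1) / real (Suc n)" if y: "y \<in> ball (c j) (r j)" for y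
  proof -
    have "ramp (real (Suc n) * p i y - 1) = 0" if "i \<in> I" "i \<noteq> j" for i
    proof (rule ramp_nonpos)
      have "p i y \<le> 0"
        using p_pos_iff[OF that(1), of y] indicator_other[OF j(1) that y] by linarith
      then show "real (Suc n) * p i y - 1 \<le> 0"
        using mult_nonneg_nonpos[of "real (Suc n)" "p i y"] by linarith
    qed
    then show ?thesis
      unfolding approx_def using finite_I j(1)
      by (subst sum.mono_neutral_right[of _ "{j}"]) auto
  qed
  then show "approx n x = ramp (real (Suc n) * p j x - 1) / real (Suc n)" using j(2) by blast
  let ?s = "bump 0 (real (Suc n) * p j x - 1) + bump 1 (real (Suc n) * p j x - 1)"
  have "(p j has_derivative (\<lambda>h. g x \<bullet> h)) (at x)"
    unfolding g_eq[OF j] by (rule p_has_derivative)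
  from has_derivative_diff[OF has_derivative_mult_right[OF this] has_derivative_const]
  have "((\<lambda>x. real (Suc n) * p j x - 1) has_derivative (\<lambda>h. real (Suc n) * (g x \<bullet> h) - 0)) (at x)" .
  from has_derivative_compose[OF this ramp_has_derivative[unfolded has_field_derivative_def]]
  have "((\<lambda>x. ramp (real (Suc n) * p j x - 1)) has_derivative
      (\<lambda>h. ?s * (real (Suc n) * (g x \<bullet> h) - 0))) (at x)" .
  from has_derivative_mult_left[OF this, of "1 / real (Suc n)"]
  have "((\<lambda>x. ramp (real (Suc n) * p j x - 1) * (1 / real (Suc n))) has_derivative
      (\<lambda>h. (?s *\<^sub>R g x) \<bullet> h)) (at x)"
    by (rule has_derivative_eq_rhs, intro ext) (simp del: of_nat_Suc)
  then have "(approx n has_derivative (\<lambda>h. (?s *\<^sub>R g x) \<bullet> h)) (at x)"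
    by (rule has_derivative_transform_within_open[OF _ open_ball j(2)]) (simp add: eq)
  then show "classical_grad (approx n) x = ?s *\<^sub>R g x"
    by (rule classical_grad_eqI)
qed

lemma w_H10: "w \<in> H10 \<Omega>"
proof (rule H10I[OF open_\<Omega> lmeasurable_\<Omega> has_weak_grad_w test_function_approx])
  let ?M = "lebesgue_on \<Omega>"
  note wg = has_weak_gradD[OF has_weak_grad_w]
  note tg = has_weak_gradD[OF test_function_has_weak_grad[OF open_\<Omega> lmeasurable_\<Omega> test_function_approx]]
  have const: "integrable ?M (\<lambda>x. 1 :: real)"
    by (rule finite_measure.integrable_const[OF finite_measure_lebesgue_on[OF lmeasurable_\<Omega>]])
  have top: "filterlim (\<lambda>n. real (Suc n) * p j x - 1) at_top sequentially"
    if "j \<in> I" "x \<in> ball (c j) (r j)" for j x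
  proof -
    have "filterlim (\<lambda>n. real (Suc n) * p j x) at_top sequentially"
      using p_pos_iff[OF that(1)] that(2)
      by (intro filterlim_at_top_mult_tendsto_pos[OF tendsto_const]
          filterlim_compose[OF filterlim_real_sequentially filterlim_Suc]) blast
    from filterlim_tendsto_add_at_top[OF tendsto_const this, of "-1"] show ?thesis by simp
  qed
  have 1: "(\<lambda>n. LINT x|?M. (w x - approx n x)\<^sup>2) \<longlonglongrightarrow> (LINT x|?M. 0)"
  proof (rule integral_dominated_convergence[where w = "\<lambda>_. 1"])
    show "AE x in ?M. (\<lambda>n. (w x - approx n x)\<^sup>2) \<longlonglongrightarrow> 0"
    proof (rule AE_I2)
      fix x assume "x \<in> space ?M"
      then obtain j where j: "j \<in> I" "x \<in> ball (c j) (r j)" by (auto simp: \<Omega>_def)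
      \<comment> \<open>This product is \<open>approx n x\<close> with the definition of
        \<open>ramp\<close> unfolded and \<open>Suc n\<close> divided out; inside the ball
        \<open>p j x > 0\<close>, so the argument of \<open>bump 0\<close> tends to
        infinity.\<close>
      have "(\<lambda>n. (p j x - 1 / real (Suc n)) * bump 0 (real (Suc n) * p j x - 1)) \<longlonglongrightarrow> (p j x - 0) * 1"
        by (intro tendsto_intros filterlim_compose[OF bump_tendsto_at_top(1) top[OF j]]
            LIMSEQ_Suc[OF lim_1_over_n])
      moreover have "(p j x - 1 / real (Suc n)) * bump 0 (real (Suc n) * p j x - 1) = approx n x" for n
        by (simp add: approx_on_ball(1)[OF j] ramp_def field_simps del: of_nat_Suc)
      ultimately have "(\<lambda>n. approx n x) \<longlonglongrightarrow> w x"
        by (simp add: w_eq[OF j])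
      then have "(\<lambda>n. (w x - approx n x)\<^sup>2) \<longlonglongrightarrow> (w x - w x)\<^sup>2"
        by (intro tendsto_intros)
      then show "(\<lambda>n. (w x - approx n x)\<^sup>2) \<longlonglongrightarrow> 0" by simp
    qed
    show "AE x in ?M. norm ((w x - approx n x)\<^sup>2) \<le> 1" for n
    proof (rule AE_I2)
      fix x assume "x \<in> space ?M"
      then have x: "x \<in> \<Omega>" by simp
      then obtain j where j: "j \<in> I" "x \<in> ball (c j) (r j)" by (auto simp: \<Omega>_def)
      \<comment> \<open>Together with \<open>0 \<le> approx n x\<close> and
        \<open>w x \<le> 1\<close> this gives the dominating constant 1.\<close>
      have "approx n x \<le> w x"
      proof (cases "0 \<le> real (Suc n) * p j x - 1")
        case True
        then have "approx n x \<le> (real (Suc n) * p j x - 1) / real (Suc n)"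
          unfolding approx_on_ball(1)[OF j] using ramp_bounds(2) by (intro divide_right_mono) auto
        also have "\<dots> \<le> p j x" by (simp add: field_simps)
        finally show ?thesis by (simp add: w_eq[OF j])
      next
        case False
        then show ?thesis
          unfolding approx_on_ball(1)[OF j] using w_bounds(1)[OF x] by (simp add: ramp_nonpos)
      qed
      moreover have "0 \<le> approx n x"
        unfolding approx_on_ball(1)[OF j] using ramp_bounds(1) by simp
      ultimately have "\<bar>w x - approx n x\<bar> \<le> 1" using w_bounds(2)[OF x] by linarith
      then show "norm ((w x - approx n x)\<^sup>2) \<le> 1"
        by (simp add: abs_square_le_1)
    qed
  qed (use wg tg const in auto)
  have 2: "(\<lambda>n. LINT x|?M. (norm (g x - classical_grad (approx n) x))\<^sup>2) \<longlonglongrightarrow> (LINT x|?M. 0)"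
  proof (rule integral_dominated_convergence[where w = "\<lambda>_. 1"])
    have eq: "(norm (g x - classical_grad (approx n) x))\<^sup>2 =
        (\<bar>1 - (bump 0 (real (Suc n) * p j x - 1) + bump 1 (real (Suc n) * p j x - 1))\<bar> * norm (g x))\<^sup>2"
      if "j \<in> I" "x \<in> ball (c j) (r j)" for j x n
    proof -
      have "g x - classical_grad (approx n) x =
        (1 - (bump 0 (real (Suc n) * p j x - 1) + bump 1 (real (Suc n) * p j x - 1))) *\<^sub>R g x"
        unfolding approx_on_ball(2)[OF that] by (simp add: scaleR_diff_left)
      then show ?thesis by simp
    qed
    show "AE x in ?M. (\<lambda>n. (norm (g x - classical_grad (approx n) x))\<^sup>2) \<longlonglongrightarrow> 0"
    proof (rule AE_I2)
      fix x assume "x \<in> space ?M"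
      then obtain j where j: "j \<in> I" "x \<in> ball (c j) (r j)" by (auto simp: \<Omega>_def)
      have "(\<lambda>n. (\<bar>1 - (bump 0 (real (Suc n) * p j x - 1) + bump 1 (real (Suc n) * p j x - 1))\<bar> * norm (g x))\<^sup>2)
          \<longlonglongrightarrow> (\<bar>1 - (1 + 0)\<bar> * norm (g x))\<^sup>2"
        by (intro tendsto_intros filterlim_compose[OF bump_tendsto_at_top(1) top[OF j]]
            filterlim_compose[OF bump_tendsto_at_top(2) top[OF j]])
      then show "(\<lambda>n. (norm (g x - classical_grad (approx n) x))\<^sup>2) \<longlonglongrightarrow> 0"
        unfolding eq[OF j] by simp
    qed
    show "AE x in ?M. norm ((norm (g x - classical_grad (approx n) x))\<^sup>2) \<le> 1" for n
    proof (rule AE_I2)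
      fix x assume "x \<in> space ?M"
      then have x: "x \<in> \<Omega>" by simp
      then obtain j where j: "j \<in> I" "x \<in> ball (c j) (r j)" by (auto simp: \<Omega>_def)
      let ?t = "real (Suc n) * p j x - 1"
      \<comment> \<open>Each bump lies between 0 and 1, so the sum lies between 0 and 2 and differs
        from 1 by at most 1.\<close>
      have "\<bar>1 - (bump 0 ?t + bump 1 ?t)\<bar> \<le> 1"
        using bump_0_le_1[of ?t] bump_1_le_1[of ?t] bump_nonneg[of 0 ?t] bump_nonneg[of 1 ?t] by linarith
      then have "\<bar>1 - (bump 0 ?t + bump 1 ?t)\<bar> * norm (g x) \<le> 1"
        using w_bounds(3)[OF x] by (intro mult_le_one) auto
      then have "(\<bar>1 - (bump 0 ?t + bump 1 ?t)\<bar> * norm (g x))\<^sup>2 \<le> 1"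
        by (intro power_le_one) auto
      then show "norm ((norm (g x - classical_grad (approx n) x))\<^sup>2) \<le> 1"
        unfolding eq[OF j] by simp
    qed
  qed (use wg tg const in auto)
  show "(\<lambda>n. (LINT x|?M. (w x - approx n x)\<^sup>2)
      + (LINT x|?M. (norm (g x - classical_grad (approx n) x))\<^sup>2)) \<longlonglongrightarrow> 0"
    using tendsto_add[OF 1 2] by simp
qed

section \<open>Volume and torsional rigidity of the union\<close>

lemma measure_\<Omega>: "measure lebesgue \<Omega> = (\<Sum>i\<in>I. r i ^ DIM('a)) * measure lebesgue (ball (0::'a) 1)"
proof -
  have "measure lebesgue \<Omega> = (\<Sum>i\<in>I. measure lebesgue (ball (c i) (r i)))"
    unfolding \<Omega>_def
  proof (rule measure_finite_Union[OF finite_I _ disj])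
    show "emeasure lebesgue (ball (c i) (r i)) \<noteq> \<infinity>" for i
      using fmeasurableD2[OF lmeasurable_ball] by simp
  qed auto
  also have "\<dots> = (\<Sum>i\<in>I. r i ^ DIM('a) * measure lebesgue (ball (0::'a) 1))"
  proof (rule sum.cong[OF refl])
    show "measure lebesgue (ball (c i) (r i)) = r i ^ DIM('a) * measure lebesgue (ball (0::'a) 1)"
      if "i \<in> I" for i
      using content_ball_conv_unit_ball[of "r i" "c i"] r_pos[OF that] by simp
  qed
  finally show ?thesis by (simp add: sum_distrib_right)
qed

text \<open>The crude estimate \<open>p_le\<close> replaces the exact integral over each ball by the
  squared radius times the volume. It already has the right power of the radius, and the constant is
  irrelevant in the limit.\<close>

lemma torsional_rigidity_bounds:
  "0 \<le> torsional_rigidity \<Omega>"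
  "torsional_rigidity \<Omega> \<le> (\<Sum>i\<in>I. r i ^ (DIM('a) + 2)) * measure lebesgue (ball (0::'a) 1)"
proof -
  let ?M = "lebesgue_on \<Omega>"
  have T: "torsional_rigidity \<Omega> = (LINT x|?M. w x)"
    by (rule torsional_rigidity_eq[OF weak_torsion_solutionI[OF open_\<Omega> lmeasurable_\<Omega> w_H10
            has_weak_grad_w w_bounds(3) integral_g_inner_grad]])
  show "0 \<le> torsional_rigidity \<Omega>"
    unfolding T using w_bounds(1) by (intro integral_nonneg_AE AE_I2) simp
  have int: "integrable ?M (\<lambda>x. indicat_real (ball (c i) (r i)) x)" for i
  proof (rule integrable_lebesgue_on_bounded[OF lmeasurable_\<Omega>, where B=1])
    show "indicat_real (ball (c i) (r i)) \<in> borel_measurable ?M"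
      by (intro measurable_restrict_space1 borel_measurable_indicator) simp
  qed (simp add: indicator_def)
  have sub: "ball (c i) (r i) \<subseteq> \<Omega>" if "i \<in> I" for i
    using that by (auto simp: \<Omega>_def)
  have "(LINT x|?M. w x) \<le> (LINT x|?M. (\<Sum>i\<in>I. (r i)\<^sup>2 * indicat_real (ball (c i) (r i)) x))"
  proof (rule integral_mono)
    show "integrable ?M w"
      using has_weak_gradD(1)[OF has_weak_grad_w] w_bounds(1,2)
      by (intro integrable_lebesgue_on_bounded[OF lmeasurable_\<Omega>, where B=1]) auto
    show "integrable ?M (\<lambda>x. \<Sum>i\<in>I. (r i)\<^sup>2 * indicat_real (ball (c i) (r i)) x)"
      using int by (intro Bochner_Integration.integrable_sum integrable_mult_right)
    show "w x \<le> (\<Sum>i\<in>I. (r i)\<^sup>2 * indicat_real (ball (c i) (r i)) x)" for x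
      unfolding w_def by (intro sum_mono) (auto simp: indicator_def p_le)
  qed
  also have "\<dots> = (\<Sum>i\<in>I. (r i)\<^sup>2 * (LINT x|?M. indicat_real (ball (c i) (r i)) x))"
    using int by simp
  also have "\<dots> = (\<Sum>i\<in>I. r i ^ (DIM('a) + 2) * measure lebesgue (ball (0::'a) 1))"
  proof (rule sum.cong[OF refl])
    fix i assume i: "i \<in> I"
    have "(LINT x|?M. indicat_real (ball (c i) (r i)) x) = measure lebesgue (ball (c i) (r i))"
      using sub[OF i] open_\<Omega>
      by (simp add: measure_restrict_space Int_absorb2)
    then show "(r i)\<^sup>2 * (LINT x|?M. indicat_real (ball (c i) (r i)) x) =
        r i ^ (DIM('a) + 2) * measure lebesgue (ball (0::'a) 1)"
      using content_ball_conv_unit_ball[of "r i" "c i"] r_pos[OF i] by (simp add: power_add power2_eq_square)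
  qed
  finally show "torsional_rigidity \<Omega> \<le> (\<Sum>i\<in>I. r i ^ (DIM('a) + 2)) * measure lebesgue (ball (0::'a) 1)"
    unfolding T by (simp add: sum_distrib_right)
qed

end

section \<open>The minimizing sequence\<close>

text \<open>The centers lie on one axis at spacing 3, more than the sum of any two radii, as these
  are at most 1. Index 0 is placed at the origin for the unit ball.\<close>

definition center :: "'a::euclidean_space \<Rightarrow> nat \<Rightarrow> 'a" where
  "center e i = (3 * real i) *\<^sub>R e"

definition radius :: "nat \<Rightarrow> nat \<Rightarrow> real" where
  "radius n i = (if i = 0 then 1 else 1 / real n)"

lemma disjoint_balls_center_radius:
  fixes e :: "'a::euclidean_space"
  assumes n: "n \<ge> 1" and e: "e \<in> Basis" and I: "finite I"
  shows "disjoint_balls I (center e) (radius n)"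
proof
  have rad: "0 < radius n i" "radius n i \<le> 1" for i
    using n by (auto simp: radius_def)
  then show "0 < radius n i" "radius n i \<le> 1" for i
    by auto
  show "disjoint_family_on (\<lambda>i. ball (center e i) (radius n i)) I"
    unfolding disjoint_family_on_def
  proof (intro ballI impI)
    fix i j :: nat assume "i \<noteq> j"
    have "center e i - center e j = (3 * real i - 3 * real j) *\<^sub>R e"
      by (simp only: center_def scaleR_diff_left)
    then have "dist (center e i) (center e j) = \<bar>3 * real i - 3 * real j\<bar>"
      using e by (simp add: dist_norm)
    moreover have "\<bar>real i - real j\<bar> \<ge> 1" using \<open>i \<noteq> j\<close> by linarith
    ultimately have "radius n i + radius n j \<le> dist (center e i) (center e j)"
      using rad(2)[of i] rad(2)[of j] by linarith
    then show "ball (center e i) (radius n i) \<inter> ball (center e j) (radius n j) = {}"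
      by (rule disjoint_ballI)
  qed
qed (rule I)

text \<open>The range of indices has \<open>n ^ m + 1\<close> elements: index 0 is the unit ball and
  gives the summand 1, leaving exactly \<open>n ^ m\<close> small balls. With m = d + 2 the power k
  = d gives the volume factor 1 + n^2, and k = d + 2 gives the constant 2.\<close>

lemma sum_radius_power:
  assumes n: "n \<ge> 1" and k: "k \<le> m"
  shows "(\<Sum>i\<le>n ^ m. radius n i ^ k) = 1 + real n ^ (m - k)"
proof -
  have "(\<Sum>i\<le>n ^ m. radius n i ^ k) = 1 + (\<Sum>i<n ^ m. (1 / real n) ^ k)"
    by (simp add: sum.atMost_shift radius_def)
  also have "\<dots> = 1 + real n ^ m / real n ^ k"
    by (simp add: power_divide)
  also have "\<dots> = 1 + real n ^ (m - k)"
    using n k by (simp add: power_diff)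
  finally show ?thesis .
qed

lemma exponent_pos:
  fixes q d :: real
  assumes "d \<ge> 1" "q > 2 / (d + 2)"
  shows "(d * q + 2 * q - 2) / d > 0" "q > 0"
proof -
  have "2 < q * (d + 2)" using assms by (simp add: divide_less_eq)
  then show "(d * q + 2 * q - 2) / d > 0"
    using assms(1) by (simp add: algebra_simps zero_less_divide_iff)
  have "0 < 2 / (d + 2)" using assms(1) by simp
  then show "q > 0" using assms(2) by linarith
qed

text \<open>In \<open>ereal\<close> an infimum is always a greatest lower bound, so the claim splits
  into nonnegativity of every value and upper bounds tending to 0.\<close>

theorem proposition3p2:
  fixes q :: real
  assumes "q > 2 / (real DIM('a::euclidean_space) + 2)"
  shows "(INF \<Omega>\<in>{\<Omega> :: 'a set. open \<Omega> \<and> 0 < emeasure lebesgue \<Omega> \<and> emeasure lebesgue \<Omega> < \<infinity>}.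
            ereal (F_functional q \<Omega>)) = 0"
proof (rule antisym)
  let ?A = "{\<Omega> :: 'a set. open \<Omega> \<and> 0 < emeasure lebesgue \<Omega> \<and> emeasure lebesgue \<Omega> < \<infinity>}"
  show "0 \<le> (INF \<Omega>\<in>?A. ereal (F_functional q \<Omega>))"
  proof (rule INF_greatest)
    fix \<Omega> assume "\<Omega> \<in> ?A"
    then have "open \<Omega>" "\<Omega> \<in> lmeasurable" "\<Omega> \<noteq> {}"
      by (auto intro: lmeasurable_openI)
    \<comment> \<open>The \<open>powr\<close> factors are nonnegative by themselves, so nothing
      about the torsion function of a general set is used.\<close>
    from first_eigenvalue_nonneg[OF this] show "0 \<le> ereal (F_functional q \<Omega>)"
      by (simp add: F_functional_def)
  qed
  define s where "s = (real DIM('a) * q + 2 * q - 2) / real DIM('a)"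
  have s: "s > 0" and q: "q > 0"
    using exponent_pos[OF DIM_ge_1 assms] by (auto simp: s_def)
  define V where "V = measure lebesgue (ball (0::'a) 1)"
  have V: "V > 0" using content_ball_pos[of 1 "0::'a"] by (simp add: V_def)
  have ball1: "open (ball (0::'a) 1)" "ball (0::'a) 1 \<noteq> {}" by auto
  obtain \<phi> :: "'a \<Rightarrow> real" where \<phi>: "test_function (ball 0 1) \<phi>"
    "\<not> (AE x in lebesgue_on (ball 0 1). \<phi> x = 0)"
    using ex_test_function[OF ball1] by blast
  \<comment> \<open>Fixed before n is introduced: the trial function lives on the unit ball, which
    all the competitors contain.\<close>
  define L where "L = (LINT x|lborel. (norm (classical_grad \<phi> x))\<^sup>2) / (LINT x|lborel. (\<phi> x)\<^sup>2)"
  have L: "L \<ge> 0" unfolding L_def by simp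
  obtain e :: 'a where e: "e \<in> Basis" using nonempty_Basis by blast
  have bound: "(INF \<Omega>\<in>?A. ereal (F_functional q \<Omega>)) \<le>
      ereal (L * (2 * V) powr q * (((1 + (real n)\<^sup>2) * V) powr (- s)))" if n: "n \<ge> 1" for n :: nat
  proof -
    interpret disjoint_balls "{..n ^ (DIM('a) + 2)}" "center e" "radius n"
      by (rule disjoint_balls_center_radius[OF n e finite_atMost])
    have meas: "measure lebesgue \<Omega> = (1 + (real n)\<^sup>2) * V"
      using measure_\<Omega> sum_radius_power[OF n, of "DIM('a)" "DIM('a) + 2"] by (simp add: V_def)
    have T: "0 \<le> torsional_rigidity \<Omega>" "torsional_rigidity \<Omega> \<le> 2 * V"
      using torsional_rigidity_bounds sum_radius_power[OF n, of "DIM('a) + 2" "DIM('a) + 2"] by (simp_all add: V_def)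
    have sub: "ball 0 1 \<subseteq> \<Omega>"
      unfolding \<Omega>_def by (intro UN_upper[of 0, THEN order_trans[rotated]]) (auto simp: center_def radius_def)
    have test: "test_function \<Omega> \<phi>"
      using \<phi>(1) sub by (auto simp: test_function_def)
    have "\<not> (AE x in lebesgue_on \<Omega>. \<phi> x = 0)"
    proof
      assume "AE x in lebesgue_on \<Omega>. \<phi> x = 0"
      then have "AE x in lebesgue. x \<in> \<Omega> \<longrightarrow> \<phi> x = 0"
        using open_\<Omega> by (simp add: AE_restrict_space_iff)
      then have "AE x in lebesgue. x \<in> ball 0 1 \<longrightarrow> \<phi> x = 0"
        by (rule AE_mp) (use sub in \<open>auto intro!: AE_I2\<close>)
      with \<phi>(2) show False by (simp add: AE_restrict_space_iff)
    qed
    from first_eigenvalue_le[OF open_\<Omega> lmeasurable_\<Omega> test this]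
    have eig: "first_eigenvalue \<Omega> \<le> L" by (simp add: L_def)
    have pos: "0 < measure lebesgue \<Omega>"
      unfolding meas using V by (intro mult_pos_pos add_pos_nonneg) auto
    have "\<Omega> \<in> ?A"
      using open_\<Omega> lmeasurable_\<Omega> pos
      by (auto simp: fmeasurable_def measure_def zero_less_iff_neq_zero)
    then have "(INF \<Omega>\<in>?A. ereal (F_functional q \<Omega>)) \<le> ereal (F_functional q \<Omega>)"
      by (rule INF_lower)
    also have "F_functional q \<Omega> =
        first_eigenvalue \<Omega> * torsional_rigidity \<Omega> powr q * measure lebesgue \<Omega> powr (- s)"
      by (simp add: F_functional_def s_def powr_minus_divide)
    \<comment> \<open>Positivity of \<open>q\<close> makes \<open>powr q\<close> monotone in the
      rigidity; the volume is known exactly and is kept.\<close>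
    also have "ereal \<dots> \<le> ereal (L * (2 * V) powr q * measure lebesgue \<Omega> powr (- s))"
      using eig T q L by (intro ereal_less_eq(3)[THEN iffD2] mult_mono mult_right_mono powr_mono2) auto
    finally show ?thesis unfolding meas .
  qed
  have "filterlim (\<lambda>n. (1 + (real n)\<^sup>2) * V) at_top sequentially"
  proof (rule filterlim_at_top_mult_tendsto_pos[OF tendsto_const V])
    have "filterlim (\<lambda>n. (real n)\<^sup>2) at_top sequentially"
      by (rule filterlim_pow_at_top[OF _ filterlim_real_sequentially]) simp
    then show "filterlim (\<lambda>n. 1 + (real n)\<^sup>2) at_top sequentially"
      by (rule filterlim_tendsto_add_at_top[OF tendsto_const])
  qed
  then have "(\<lambda>n. ((1 + (real n)\<^sup>2) * V) powr (- s)) \<longlonglongrightarrow> 0"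
    using s by (intro tendsto_neg_powr) auto
  then have "(\<lambda>n. L * (2 * V) powr q * (((1 + (real n)\<^sup>2) * V) powr (- s))) \<longlonglongrightarrow> L * (2 * V) powr q * 0"
    by (intro tendsto_intros)
  then have "(\<lambda>n. ereal (L * (2 * V) powr q * (((1 + (real n)\<^sup>2) * V) powr (- s)))) \<longlonglongrightarrow> ereal 0"
    by (intro tendsto_ereal) simp
  then have "(INF \<Omega>\<in>?A. ereal (F_functional q \<Omega>)) \<le> ereal 0"
    \<comment> \<open>The bound holds from n = 1 on, since for n = 0 the small radius
      \<open>1 / real n\<close> would be 0.\<close>
    by (rule LIMSEQ_le_const) (intro exI[of _ 1] allI impI bound)
  then show "(INF \<Omega>\<in>?A. ereal (F_functional q \<Omega>)) \<le> 0"
    by (simp only: zero_ereal_def)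
qed

end
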